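(* Let $m>1$ and let $\beta$ satisfy $0>\beta>(1-m)d$ and $\beta>-d$. Then for every $\varepsilon>0$ the energy $E_\varepsilon\colon\mathcal{P}(\mathbb{R}^d)\to(-\infty,\infty]$ given by $$E_\varepsilon(\rho)=\begin{cases}\displaystyle\int_{\mathbb{R}^d}\int_{\mathbb{R}^d}\frac{|x-y|^\beta}{\beta}\,d\rho(x)\,d\rho(y)+\varepsilon\int_{\mathbb{R}^d}\frac{\rho^m(x)}{m-1}\,dx&\text{for all }\rho\in\mathcal{P}(\mathbb{R}^d)\cap L^m(\mathbb{R}^d),\\[3mm]+\infty&\text{for all }\rho\in\mathcal{P}(\mathbb{R}^d)\setminus L^m(\mathbb{R}^d),\end{cases}$$ has a global minimizer.
   Context: $\mathcal{P}(\mathbb{R}^d)$ is the set of Borel probability measures on $\mathbb{R}^d$; $\rho\in\mathcal{P}(\mathbb{R}^d)\cap L^m(\mathbb{R}^d)$ means that $\rho$ is absolutely continuous with respect to Lebesgue measure with density (also denoted $\rho$) in $L^m(\mathbb{R}^d)$. A global minimizer is a $\rho\in\mathcal{P}(\mathbb{R}^d)$ with $E_\varepsilon(\rho)\le E_\varepsilon(\nu)$ for all $\nu\in\mathcal{P}(\mathbb{R}^d)$. *)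

theory Defs
  imports "HOL-Probability.Probability"
begin

definition borel_prob_measures :: "('a::euclidean_space) measure set" where
  "borel_prob_measures = {\<rho>. prob_space \<rho> \<and> sets \<rho> = sets borel}"

(* RN_deriv is a density as soon as the measure is absolutely continuous with respect to
   lborel; for a probability measure it is then finite almost everywhere, so passing to real
   values changes it on a null set only. *)
definition lebesgue_density :: "('a::euclidean_space) measure \<Rightarrow> 'a \<Rightarrow> real" where
  "lebesgue_density \<rho> x = enn2real (RN_deriv lborel \<rho> x)"

definition has_density_in_L :: "real \<Rightarrow> ('a::euclidean_space) measure \<Rightarrow> bool" where
  "has_density_in_L m \<rho> \<longleftrightarrow>
     absolutely_continuous lborel \<rho> \<and>
     integrable lborel (\<lambda>x. lebesgue_density \<rho> x powr m)"

(* Integral of positive part minus integral of negative part.  It is used only for integrands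
   of constant sign, so the value that ereal assigns to \<infinity> - \<infinity> plays no role. *)
definition ereal_integral :: "'b measure \<Rightarrow> ('b \<Rightarrow> ereal) \<Rightarrow> ereal" where
  "ereal_integral M f =
     enn2ereal (\<integral>\<^sup>+ x. e2ennreal (f x) \<partial>M) - enn2ereal (\<integral>\<^sup>+ x. e2ennreal (- f x) \<partial>M)"

(* 0 powr \<beta> = 0 in the library, so the singular value |0| powr \<beta> / \<beta> = - \<infinity> for \<beta> < 0
   is set explicitly. *)
definition interaction_kernel :: "real \<Rightarrow> 'a::euclidean_space \<Rightarrow> 'a \<Rightarrow> ereal" where
  "interaction_kernel \<beta> x y =
     (if \<beta> < 0 \<and> x = y then - \<infinity> else ereal (norm (x - y) powr \<beta> / \<beta>))"

definition energy :: "real \<Rightarrow> real \<Rightarrow> real \<Rightarrow> ('a::euclidean_space) measure \<Rightarrow> ereal" where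
  "energy m \<beta> \<epsilon> \<rho> =
     (if has_density_in_L m \<rho>
      then ereal_integral \<rho> (\<lambda>y. ereal_integral \<rho> (\<lambda>x. interaction_kernel \<beta> x y))
           + ereal (\<epsilon> * (LINT x|lborel. lebesgue_density \<rho> x powr m / (m - 1)))
      else \<infinity>)"

definition global_minimizer ::
  "(('a::euclidean_space) measure \<Rightarrow> ereal) \<Rightarrow> 'a measure \<Rightarrow> bool" where
  "global_minimizer E \<rho> \<longleftrightarrow>
     \<rho> \<in> borel_prob_measures \<and> (\<forall>\<nu>\<in>borel_prob_measures. E \<rho> \<le> E \<nu>)"

end

theory Submission
  imports Defs
begin

text \<open>
  Write \<open>\<alpha> = - \<beta>\<close>, \<open>W(u) = \<integral>\<integral> |x - y|\<^sup>-\<^sup>\<alpha> u(x) u(y)\<close> and \<open>P(u) = \<integral> u\<^sup>m\<close>. A bathtub argument gives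
  \<open>W(u) \<le> C \<integral> u\<^bsup>1 + \<alpha>/d\<^esup>\<close>, and \<open>1 + \<alpha>/d < m\<close> makes the energy bounded below; localised
  to small distances or small masses, the same estimate shows that the interaction of close points
  is uniformly small and that minimising sequences do not vanish. Dilations show that the optimal
  value for mass \<open>M\<close> is \<open>M\<^sup>\<gamma>\<close> times a negative number with \<open>\<gamma> > 1\<close>. By this strict
  subadditivity a near-minimiser cannot be cut along an annulus of small mass into two substantial
  pieces, so near-minimisers are tight up to translation. Tightness and the bound on \<open>P\<close> give a
  setwise cluster point of the product measures \<open>\<rho>\<^sub>n \<otimes> \<rho>\<^sub>n\<close>; it is itself a product \<open>\<rho> \<otimes> \<rho>\<close>, the far
  part of \<open>W\<close> converges and \<open>P\<close> is lower semicontinuous, whence \<open>\<rho>\<close> is a minimiser.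
\<close>

section \<open>Setwise cluster points of probability measures\<close>

text \<open>Two obstacles shape the proof: compactness is lost under translations, and the kernel is
  singular on the diagonal. Setwise convergence tests all bounded measurable functions, so the
  kernel may be cut off sharply at a distance \<open>r\<close> although the result is discontinuous;
  and W, quadratic in the density, is linear in the product measure. The price is uniform
  integrability in the spirit of Dunford-Pettis, stated here as domination by a finite measure up to
  \<delta>. The bound on P excludes concentration, tightness excludes escape to infinity. The two
  bounds on \<alpha> act separately. \<alpha> < d makes the kernel locally integrable and is also
  what gives \<gamma> > 1. \<alpha> < (m - 1) d makes diffusion win at high densities; under
  spreading, attraction decays more slowly than diffusion, so the optimal energy is strictly
  negative. That strict sign both rules out vanishing and turns \<gamma> > 1 into a definite loss
  when mass is split.\<close>

text \<open>The compactness of \<open>[0, 1]\<close> to the power of all sets yields a cluster point \<open>f\<close> of the set functions;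
  the domination makes \<open>f\<close> continuous at the empty set.\<close>

lemma setwise_cluster_point:
  fixes \<nu> :: "nat \<Rightarrow> 'b measure"
  assumes prob: "\<And>n. prob_space (\<nu> n)" and sets_eq: "\<And>n. sets (\<nu> n) = sets M"
    and dom: "\<And>\<delta>::real. \<delta> > 0 \<Longrightarrow> \<exists>\<Lambda>. finite_measure \<Lambda> \<and> sets \<Lambda> = sets M \<and>
      (\<forall>\<^sub>F n in sequentially. \<forall>A\<in>sets M. measure (\<nu> n) A \<le> measure \<Lambda> A + \<delta>)"
  obtains G \<mu> where "G \<noteq> bot" "G \<le> sequentially" "prob_space \<mu>" "sets \<mu> = sets M"
    "\<And>A. A \<in> sets M \<Longrightarrow> ((\<lambda>n. measure (\<nu> n) A) \<longlongrightarrow> measure \<mu> A) G"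
proof -
  define g where "g n A = (measure (\<nu> n) A :: real)" for n A
  have "compact (PiE UNIV (\<lambda>_::'b set. {0..1::real}))"
    using compactin_PiE[of "\<lambda>_. euclidean :: real topology" UNIV "\<lambda>_::'b set. {0..1::real}"]
    by (auto simp: euclidean_product_topology)
  moreover have "\<forall>\<^sub>F h in filtermap g sequentially. h \<in> PiE UNIV (\<lambda>_::'b set. {0..1::real})"
    using prob by (auto simp: eventually_filtermap g_def prob_space.prob_le_1 intro!: always_eventually)
  moreover have "filtermap g sequentially \<noteq> bot"
    by (simp add: filtermap_bot_iff)
  ultimately obtain f where f: "inf (nhds f) (filtermap g sequentially) \<noteq> bot"
    unfolding compact_filter by blast
  \<comment> \<open>The product over all sets need not be first countable, so no subsequence is
    extracted. The filter \<open>G\<close> of indices along which \<open>g\<close> tends to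
    \<open>f\<close> takes its place; it is proper because \<open>f\<close> is a cluster
    point.\<close>
  define G where "G = inf (filtercomap g (nhds f)) sequentially"
  have G: "G \<noteq> bot"
  proof
    assume "G = bot"
    then have "\<forall>\<^sub>F x in G. False" by simp
    then obtain P Q where P: "eventually P (nhds f)" and Q: "eventually Q sequentially"
      and PQ: "\<And>x. P (g x) \<Longrightarrow> Q x \<Longrightarrow> False"
      unfolding G_def eventually_inf eventually_filtercomap by (metis (full_types))
    have "eventually (\<lambda>h. \<not> P h) (filtermap g sequentially)"
      unfolding eventually_filtermap using Q by eventually_elim (use PQ in blast)
    then have "eventually (\<lambda>_. False) (inf (nhds f) (filtermap g sequentially))"
      unfolding eventually_inf using P by blast
    then show False using f by (simp add: eventually_False)
  qed
  have Gs: "G \<le> sequentially" by (simp add: G_def)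
  have lim_f: "(g \<longlongrightarrow> f) G"
    unfolding filterlim_def G_def
    by (metis filtermap_inf filtermap_filtercomap inf.coboundedI1 order_trans)
  have lim: "((\<lambda>n. measure (\<nu> n) A) \<longlongrightarrow> f A) G" for A
  proof -
    have "continuous_on UNIV (\<lambda>h::'b set \<Rightarrow> real. h A)"
      by (rule continuous_on_product_coordinates)
    from continuous_on_tendsto_compose[OF this lim_f] show ?thesis by (simp add: g_def)
  qed
  have f_nonneg: "0 \<le> f A" for A
    by (rule tendsto_lowerbound[OF lim _ G]) auto
  have f_add: "f (A \<union> B) = f A + f B" if "A \<in> sets M" "B \<in> sets M" "A \<inter> B = {}" for A B
  proof -
    have "measure (\<nu> n) (A \<union> B) = measure (\<nu> n) A + measure (\<nu> n) B" for n
    proof -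
      interpret prob_space "\<nu> n" by (rule prob)
      show ?thesis using that by (intro finite_measure_Union) (auto simp: sets_eq)
    qed
    then show ?thesis
      using tendsto_add[OF lim[of A] lim[of B]] lim[of "A \<union> B"] tendsto_unique[OF G] by auto
  qed
  have f_empty: "f {} = 0" using lim[of "{}"] tendsto_unique[OF G _ tendsto_const, of 0] by simp
  have f_space: "f (space M) = 1"
  proof -
    have "measure (\<nu> n) (space M) = 1" for n
      using prob_space.prob_space[OF prob[of n]] sets_eq_imp_space_eq[OF sets_eq[of n]] by simp
    then show ?thesis using lim[of "space M"] tendsto_unique[OF G _ tendsto_const, of 1] by simp
  qed
  have cont: "(\<lambda>i. ennreal (f (A i))) \<longlonglongrightarrow> 0"
    if A: "range A \<subseteq> sets M" "decseq A" "(\<Inter>i. A i) = {}" for A :: "nat \<Rightarrow> 'b set"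
  proof -
    have "(\<lambda>i. f (A i)) \<longlonglongrightarrow> 0"
    proof (rule LIMSEQ_I)
      fix r :: real assume "r > 0"
      then obtain \<Lambda> where \<Lambda>: "finite_measure \<Lambda>" "sets \<Lambda> = sets M"
        and ev: "\<forall>\<^sub>F n in sequentially. \<forall>A\<in>sets M. measure (\<nu> n) A \<le> measure \<Lambda> A + r/2"
        using dom[of "r/2"] by auto
      interpret L: finite_measure \<Lambda> by fact
      have "(\<lambda>i. measure \<Lambda> (A i)) \<longlonglongrightarrow> measure \<Lambda> (\<Inter>i. A i)"
        using A \<Lambda>(2) by (intro L.finite_Lim_measure_decseq) auto
      then have "(\<lambda>i. measure \<Lambda> (A i)) \<longlonglongrightarrow> 0" using A(3) by simp
      then obtain N where N: "\<And>i. i \<ge> N \<Longrightarrow> measure \<Lambda> (A i) < r/2"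
        using \<open>r > 0\<close> LIMSEQ_D[of _ 0 "r/2"] by fastforce
      have "f (A i) < r" if "i \<ge> N" for i
      proof -
        have "\<forall>\<^sub>F n in G. measure (\<nu> n) (A i) \<le> measure \<Lambda> (A i) + r/2"
          using filter_leD[OF Gs ev] by eventually_elim (use A(1) in auto)
        then have "f (A i) \<le> measure \<Lambda> (A i) + r/2"
          by (rule tendsto_upperbound[OF lim _ G])
        then show ?thesis using N[OF that] by simp
      qed
      then show "\<exists>no. \<forall>n\<ge>no. norm (f (A n) - 0) < r"
        using f_nonneg by auto
    qed
    then show ?thesis using tendsto_ennrealI by fastforce
  qed
  define \<mu> where "\<mu> = measure_of (space M) (sets M) (\<lambda>A. ennreal (f A))"
  have sets_\<mu>: "sets \<mu> = sets M" and space_\<mu>: "space \<mu> = space M"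
    by (auto simp: \<mu>_def)
  have pos: "positive (sets M) (\<lambda>A. ennreal (f A))" by (auto simp: positive_def f_empty)
  have add: "additive (sets M) (\<lambda>A. ennreal (f A))"
    using f_add f_nonneg by (auto simp: additive_def ennreal_plus[symmetric] simp del: ennreal_plus)
  have "countably_additive (sets M) (\<lambda>A. ennreal (f A))"
    by (rule sets.empty_continuous_imp_countably_additive[OF pos add]) (use cont in auto)
  then have em: "emeasure \<mu> A = ennreal (f A)" if "A \<in> sets M" for A
    using emeasure_measure_of_sigma[OF sets.sigma_algebra_axioms pos _ that] by (simp add: \<mu>_def)
  have "prob_space \<mu>"
    by (rule prob_spaceI) (simp add: space_\<mu> em f_space)
  moreover have "measure \<mu> A = f A" if "A \<in> sets M" for A
    using em[OF that] f_nonneg by (simp add: measure_def)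
  ultimately show ?thesis
    using that[OF G Gs _ sets_\<mu>] lim by simp
qed

text \<open>A function with values in the unit interval is, up to \<open>1/N\<close>, the mean of the indicators
  of its superlevel sets \<open>{f \<ge> i/N}\<close>.\<close>

lemma setwise_limit_integral_unit:
  fixes f :: "'b \<Rightarrow> real"
  assumes prob: "\<And>n. prob_space (\<nu> n)" and sets_eq: "\<And>n. sets (\<nu> n) = sets M"
    and mu: "prob_space \<mu>" "sets \<mu> = sets M"
    and lim: "\<And>A. A \<in> sets M \<Longrightarrow> ((\<lambda>n. measure (\<nu> n) A) \<longlongrightarrow> measure \<mu> A) G"
    and f: "f \<in> borel_measurable M" and f01: "\<And>x. 0 \<le> f x" "\<And>x. f x \<le> 1"
  shows "((\<lambda>n. integral\<^sup>L (\<nu> n) f) \<longlongrightarrow> integral\<^sup>L \<mu> f) G"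
proof (rule tendstoI)
  fix e :: real assume "e > 0"
  obtain N :: nat where N: "N > 0" "1 / real N < e/3"
    using \<open>e > 0\<close> nat_approx_posE[of "e/3"] by (metis divide_pos_pos zero_less_Suc zero_less_numeral)
  define A where "A i = {x\<in>space M. real i / real N \<le> f x}" for i
  have A: "A i \<in> sets M" for i unfolding A_def using f by measurable
  define s where "s x = (\<Sum>i\<in>{1..N}. indicator (A i) x) / real N" for x
  have s: "s x \<le> f x \<and> f x \<le> s x + 1 / real N" if "x \<in> space M" for x
  proof -
    \<comment> \<open>Hence \<open>s x\<close> is \<open>f x\<close> rounded down to a multiple of
      1/N. The sum starts at 1 because \<open>A 0\<close> is the whole space.\<close>
    have *: "real i / real N \<le> f x \<longleftrightarrow> i \<le> nat \<lfloor>f x * real N\<rfloor>" for i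
      using N f01(1)[of x] by (simp add: field_simps le_nat_floor le_nat_iff le_floor_iff)
    have "f x * real N \<le> real N" using f01(2)[of x] by (intro mult_left_le_one_le) (use f01(1) in auto)
    then have "nat \<lfloor>f x * real N\<rfloor> \<le> N" by (simp add: floor_le_iff nat_le_iff)
    have "(\<Sum>i\<in>{1..N}. indicator (A i) x) = real (card {i\<in>{1..N}. i \<le> nat \<lfloor>f x * real N\<rfloor>})"
      using that by (auto simp: A_def * indicator_def sum.If_cases Int_def Collect_conj_eq[symmetric] intro!: arg_cong[where f=card])
    also have "{i\<in>{1..N}. i \<le> nat \<lfloor>f x * real N\<rfloor>} = {1..nat \<lfloor>f x * real N\<rfloor>}"
      using \<open>nat \<lfloor>f x * real N\<rfloor> \<le> N\<close> by auto
    finally have eq: "(\<Sum>i\<in>{1..N}. indicator (A i) x) = real (nat \<lfloor>f x * real N\<rfloor>)" by simp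
    have "real (nat \<lfloor>f x * real N\<rfloor>) \<le> f x * real N" "f x * real N \<le> real (nat \<lfloor>f x * real N\<rfloor>) + 1"
      using f01(1)[of x] by (auto simp: of_nat_nat)
    then show ?thesis using N unfolding s_def eq by (simp add: field_simps)
  qed
  have int: "\<bar>integral\<^sup>L \<rho> f - (\<Sum>i\<in>{1..N}. measure \<rho> (A i)) / real N\<bar> \<le> 1 / real N"
    if "prob_space \<rho>" and se: "sets \<rho> = sets M" for \<rho>
  proof -
    interpret prob_space \<rho> by fact
    have sp: "space \<rho> = space M" using se by (rule sets_eq_imp_space_eq)
    have Am[measurable]: "A i \<in> sets \<rho>" for i using A se by simp
    have fm[measurable]: "f \<in> borel_measurable \<rho>" using f se by simp
    have intf: "integrable \<rho> f"
      by (rule integrable_const_bound[where B=1]) (use f01 in auto)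
    have ints: "integrable \<rho> s" unfolding s_def
      by (intro integrable_divide_zero integrable_sum integrable_real_indicator) (auto simp: less_top[symmetric])
    have "integral\<^sup>L \<rho> s = (\<Sum>i\<in>{1..N}. measure \<rho> (A i)) / real N"
      unfolding s_def by (simp add: less_top[symmetric])
    moreover have "integral\<^sup>L \<rho> s \<le> integral\<^sup>L \<rho> f"
      by (rule integral_mono[OF ints intf]) (use s sp in auto)
    moreover have "integral\<^sup>L \<rho> f \<le> integral\<^sup>L \<rho> (\<lambda>x. s x + 1 / real N)"
      by (rule integral_mono[OF intf]) (use s sp ints in auto)
    moreover have "integral\<^sup>L \<rho> (\<lambda>x. s x + 1 / real N) = integral\<^sup>L \<rho> s + 1 / real N"
      using ints by (simp add: prob_space)
    ultimately show ?thesis by linarith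
  qed
  have "((\<lambda>n. (\<Sum>i\<in>{1..N}. measure (\<nu> n) (A i)) / real N) \<longlongrightarrow> (\<Sum>i\<in>{1..N}. measure \<mu> (A i)) / real N) G"
    by (intro tendsto_intros lim A) (use N in auto)
  then have "\<forall>\<^sub>F n in G. dist ((\<Sum>i\<in>{1..N}. measure (\<nu> n) (A i)) / real N)
      ((\<Sum>i\<in>{1..N}. measure \<mu> (A i)) / real N) < e/3"
    by (rule tendstoD) (use \<open>e > 0\<close> in auto)
  then show "\<forall>\<^sub>F n in G. dist (integral\<^sup>L (\<nu> n) f) (integral\<^sup>L \<mu> f) < e"
  proof eventually_elim
    case (elim n)
    then show ?case
      using int[OF prob[of n] sets_eq[of n]] int[OF mu] N(2) unfolding dist_real_def by linarith
  qed
qed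

lemma setwise_limit_integral:
  fixes f :: "'b \<Rightarrow> real"
  assumes prob: "\<And>n. prob_space (\<nu> n)" and sets_eq: "\<And>n. sets (\<nu> n) = sets M"
    and mu: "prob_space \<mu>" "sets \<mu> = sets M"
    and lim: "\<And>A. A \<in> sets M \<Longrightarrow> ((\<lambda>n. measure (\<nu> n) A) \<longlongrightarrow> measure \<mu> A) G"
    and f: "f \<in> borel_measurable M" and fb: "\<And>x. 0 \<le> f x" "\<And>x. f x \<le> b" and b: "b > 0"
  shows "((\<lambda>n. integral\<^sup>L (\<nu> n) f) \<longlongrightarrow> integral\<^sup>L \<mu> f) G"
proof -
  have "((\<lambda>n. integral\<^sup>L (\<nu> n) (\<lambda>x. f x / b)) \<longlongrightarrow> integral\<^sup>L \<mu> (\<lambda>x. f x / b)) G"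
    by (rule setwise_limit_integral_unit[OF prob sets_eq mu lim]) (use f fb b in auto)
  then have "((\<lambda>n. b * (integral\<^sup>L (\<nu> n) f / b)) \<longlongrightarrow> b * (integral\<^sup>L \<mu> f / b)) G"
    by (intro tendsto_mult tendsto_const) simp
  then show ?thesis using b by simp
qed

section \<open>The Riesz interaction\<close>

text \<open>\<open>riesz \<alpha> 0 = 0\<close> because \<open>0 powr x = 0\<close>; the diagonal is a null set for all measures with a density.\<close>

definition riesz :: "real \<Rightarrow> 'a::euclidean_space \<Rightarrow> ennreal" where
  "riesz \<alpha> z = ennreal (norm z powr (- \<alpha>))"

text \<open>Polarised and with a free kernel, so that truncated kernels, constant kernels and the
  cross terms of a cut obey the same rules.\<close>

definition interaction ::
  "('a::euclidean_space \<Rightarrow> ennreal) \<Rightarrow> ('a \<Rightarrow> real) \<Rightarrow> ('a \<Rightarrow> real) \<Rightarrow> ennreal" where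
  "interaction k u v = (\<integral>\<^sup>+x. \<integral>\<^sup>+y. k (x - y) * (ennreal (u x) * ennreal (v y)) \<partial>lborel \<partial>lborel)"

definition mass :: "('a::euclidean_space \<Rightarrow> real) \<Rightarrow> ennreal" where
  "mass u = (\<integral>\<^sup>+x. ennreal (u x) \<partial>lborel)"

definition power_mass :: "real \<Rightarrow> ('a::euclidean_space \<Rightarrow> real) \<Rightarrow> ennreal" where
  "power_mass p u = (\<integral>\<^sup>+x. ennreal (u x powr p) \<partial>lborel)"

lemma riesz_measurable[measurable]: "riesz \<alpha> \<in> borel_measurable borel"
  unfolding riesz_def by measurable

lemma riesz_minus[simp]: "riesz \<alpha> (- z) = riesz \<alpha> z"
  by (simp add: riesz_def)

lemma nn_integral_lborel_affine:
  fixes f :: "'a::euclidean_space \<Rightarrow> ennreal"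
  assumes [measurable]: "f \<in> borel_measurable borel" and c: "c \<noteq> 0"
  shows "(\<integral>\<^sup>+x. f x \<partial>lborel) = ennreal (\<bar>c\<bar> ^ DIM('a)) * (\<integral>\<^sup>+x. f (t + c *\<^sub>R x) \<partial>lborel)"
  by (subst lborel_affine[OF c, of t])
     (simp add: nn_integral_density nn_integral_distr nn_integral_cmult)

lemma nn_integral_lborel_diff:
  fixes f :: "'a::euclidean_space \<Rightarrow> ennreal"
  assumes "f \<in> borel_measurable borel"
  shows "(\<integral>\<^sup>+y. f (x - y) \<partial>lborel) = (\<integral>\<^sup>+y. f y \<partial>lborel)"
  using nn_integral_lborel_affine[OF assms, of "-1" x] by simp

text \<open>The integrand is dominated by constants on the dyadic balls of radius \<open>t / 2^i\<close>.\<close>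

lemma riesz_integral_ball:
  assumes "0 < \<alpha>" "\<alpha> < real DIM('a::euclidean_space)"
  obtains C where "C > 0" "\<And>t. t > 0 \<Longrightarrow>
    (\<integral>\<^sup>+z. riesz \<alpha> (z::'a) * indicator (ball 0 t) z \<partial>lborel) \<le> ennreal (C * t powr (real DIM('a) - \<alpha>))"
proof -
  define d where "d = real DIM('a)"
  define V where "V = unit_ball_vol (real DIM('a))"
  \<comment> \<open>\<open>q\<close> is the ratio of consecutive dyadic contributions, and \<alpha>
    < d enters as \<open>q < 1\<close>. The factor \<open>2 powr \<alpha>\<close> in
    \<open>C\<close> below appears because the ball of radius \<open>t / 2 ^ i\<close> is weighted
    with the kernel at half that radius.\<close>
  define q where "q = 2 powr (- (d - \<alpha>))"
  have V: "V > 0" by (simp add: V_def)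
  have q: "0 < q" "q < 1" using assms by (auto simp: q_def d_def powr_less_one)
  define C where "C = V * 2 powr \<alpha> * (\<Sum>i. q ^ i)"
  have "C > 0" using V q by (simp add: C_def suminf_geometric)
  moreover have "(\<integral>\<^sup>+z. riesz \<alpha> (z::'a) * indicator (ball 0 t) z \<partial>lborel) \<le> ennreal (C * t powr (d - \<alpha>))"
    if t: "t > 0" for t
  proof -
    define a where "a i = (t / 2 ^ Suc i) powr (- \<alpha>)" for i
    have pt: "riesz \<alpha> z * indicator (ball 0 t) z \<le> (\<Sum>i. ennreal (a i) * indicator (ball 0 (t / 2 ^ i)) z)" for z :: 'a
    \<comment> \<open>At \<open>z = 0\<close> the left side is 0 by the convention
      \<open>0 powr x = 0\<close>. In the remaining case the least admissible \<open>i\<close> puts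
      \<open>z\<close> into one dyadic shell, and a single summand suffices.\<close>
    proof (cases "z = 0 \<or> norm z \<ge> t")
      case True
      then show ?thesis by (auto simp: riesz_def indicator_def)
    next
      case False
      then have z: "norm z > 0" "norm z < t" by auto
      have "\<exists>i. t / 2 ^ Suc i \<le> norm z"
      proof -
        obtain n where "(1/2) ^ n < norm z / t" using z t real_arch_pow_inv[of "norm z / t" "1/2"] by auto
        then have "t / 2 ^ n < norm z" using t by (simp add: field_simps power_divide)
        moreover have "t / 2 ^ Suc n \<le> t / 2 ^ n" using t by (simp add: field_simps)
        ultimately show ?thesis by (intro exI[of _ n]) linarith
      qed
      then obtain i where i: "t / 2 ^ Suc i \<le> norm z" "\<And>j. j < i \<Longrightarrow> \<not> t / 2 ^ Suc j \<le> norm z"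
        using exists_least_iff[of "\<lambda>i. t / 2 ^ Suc i \<le> norm z"] by blast
      have "norm z < t / 2 ^ i"
      proof (cases i)
        case 0 then show ?thesis using z by simp
      next
        case (Suc j) then show ?thesis using i(2)[of j] by simp
      qed
      moreover have "norm z powr (- \<alpha>) \<le> a i"
        unfolding a_def using i(1) assms t by (intro powr_mono2') auto
      ultimately have "riesz \<alpha> z * indicator (ball 0 t) z \<le> ennreal (a i) * indicator (ball 0 (t / 2 ^ i)) z"
        using z by (simp add: riesz_def ennreal_leI)
      also have "\<dots> = (\<Sum>j\<in>{i}. ennreal (a j) * indicator (ball 0 (t / 2 ^ j)) z)"
        by (simp only: sum.insert finite.emptyI empty_iff not_False_eq_True sum.empty add_0_right)
      also have "\<dots> \<le> (\<Sum>i. ennreal (a i) * indicator (ball 0 (t / 2 ^ i)) z)"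
        by (rule sum_le_suminf) auto
      finally show ?thesis .
    qed
    have "(\<integral>\<^sup>+z. riesz \<alpha> (z::'a) * indicator (ball 0 t) z \<partial>lborel)
        \<le> (\<integral>\<^sup>+z. (\<Sum>i. ennreal (a i) * indicator (ball 0 (t / 2 ^ i)) (z::'a)) \<partial>lborel)"
      by (intro nn_integral_mono pt)
    also have "\<dots> = (\<Sum>i. ennreal (a i) * emeasure lborel (ball (0::'a) (t / 2 ^ i)))"
      by (subst nn_integral_suminf) (auto simp: nn_integral_cmult_indicator intro!: borel_measurable_times_ennreal borel_measurable_indicator)
    also have "\<dots> = (\<Sum>i. ennreal (V * 2 powr \<alpha> * t powr (d - \<alpha>) * q ^ i))"
    proof (intro suminf_cong)
      fix i
      have pos: "t / 2 ^ i > 0" "t / 2 ^ Suc i > 0" using t by auto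
      then have nz: "t / 2 ^ i \<noteq> 0" "t / 2 ^ Suc i \<noteq> 0" by linarith+
      \<comment> \<open>Powers with real and with natural exponents all become exponentials, so that
        \<open>e\<close> reduces to a linear identity between exponents.\<close>
      have ln_i: "ln (t / 2 ^ i) = ln t - real i * ln 2" "ln (t / 2 ^ Suc i) = ln t - (real i + 1) * ln 2"
        using t by (simp_all add: ln_div ln_realpow ln_mult algebra_simps)
      have 1: "a i = exp (- \<alpha> * (ln t - (real i + 1) * ln 2))"
        by (simp only: a_def powr_def nz if_False ln_i)
      have "(t / 2 ^ i) ^ DIM('a) = (t / 2 ^ i) powr d"
        unfolding d_def by (rule powr_realpow[OF pos(1), symmetric])
      then have 2: "(t / 2 ^ i) ^ DIM('a) = exp (d * (ln t - real i * ln 2))"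
        by (simp only: powr_def nz if_False ln_i)
      have 3: "q ^ i = exp (real i * (- (d - \<alpha>) * ln 2))"
        unfolding q_def powr_def by (simp add: exp_of_nat_mult)
      have 4: "2 powr \<alpha> = exp (\<alpha> * ln 2)" "t powr (d - \<alpha>) = exp ((d - \<alpha>) * ln t)"
        using t by (simp_all add: powr_def)
      have e: "a i * (t / 2 ^ i) ^ DIM('a) = 2 powr \<alpha> * t powr (d - \<alpha>) * q ^ i"
        unfolding 1 2 3 4 exp_add[symmetric] by (simp add: algebra_simps)
      have "a i * (V * (t / 2 ^ i) ^ DIM('a)) = V * (a i * (t / 2 ^ i) ^ DIM('a))" by (simp only: mult_ac)
      also have "\<dots> = V * 2 powr \<alpha> * t powr (d - \<alpha>) * q ^ i" unfolding e by (simp only: mult_ac)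
      finally have "a i * (V * (t / 2 ^ i) ^ DIM('a)) = V * 2 powr \<alpha> * t powr (d - \<alpha>) * q ^ i" .
      moreover have "emeasure lborel (ball (0::'a) (t / 2 ^ i)) = ennreal (V * (t / 2 ^ i) ^ DIM('a))"
        unfolding V_def using pos(1) by (intro emeasure_ball) simp
      moreover have "0 \<le> a i" "0 \<le> V * (t / 2 ^ i) ^ DIM('a)" using pos(1) V by (auto simp: a_def)
      ultimately show "ennreal (a i) * emeasure lborel (ball (0::'a) (t / 2 ^ i)) = ennreal (V * 2 powr \<alpha> * t powr (d - \<alpha>) * q ^ i)"
        by (metis ennreal_mult)
    qed
    also have "\<dots> = ennreal (\<Sum>i. V * 2 powr \<alpha> * t powr (d - \<alpha>) * q ^ i)"
      using q V by (intro suminf_ennreal2) (auto intro!: summable_mult summable_geometric)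
    also have "(\<Sum>i. V * 2 powr \<alpha> * t powr (d - \<alpha>) * q ^ i) = C * t powr (d - \<alpha>)"
      using q by (subst suminf_mult) (auto simp: C_def)
    finally show ?thesis .
  qed
  ultimately show ?thesis using that by (auto simp: d_def)
qed

text \<open>Bathtub estimate: the potential is split at the radius \<open>t\<close> with \<open>h t\<^sup>d = \<eta>\<close>.\<close>

lemma riesz_potential_bound:
  assumes "0 < \<alpha>" "\<alpha> < real DIM('a::euclidean_space)"
  obtains C where "C > 0" "\<And>(v::'a \<Rightarrow> real) x h \<eta>. v \<in> borel_measurable borel \<Longrightarrow> (\<And>y. v y \<le> h) \<Longrightarrow>
     h > 0 \<Longrightarrow> \<eta> > 0 \<Longrightarrow> mass v \<le> ennreal \<eta> \<Longrightarrow>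
     (\<integral>\<^sup>+y. riesz \<alpha> (x - y) * ennreal (v y) \<partial>lborel)
       \<le> ennreal (C * h powr (\<alpha> / real DIM('a)) * \<eta> powr (1 - \<alpha> / real DIM('a)))"
proof -
  define d where "d = real DIM('a)"
  have d: "d > 0" by (simp add: d_def)
  obtain C0 where C0: "C0 > 0" "\<And>t. t > 0 \<Longrightarrow>
    (\<integral>\<^sup>+z. riesz \<alpha> (z::'a) * indicator (ball 0 t) z \<partial>lborel) \<le> ennreal (C0 * t powr (d - \<alpha>))"
    using riesz_integral_ball[OF assms] unfolding d_def by blast
  have main: "(\<integral>\<^sup>+y. riesz \<alpha> (x - y) * ennreal (v y) \<partial>lborel)
       \<le> ennreal ((C0 + 1) * h powr (\<alpha> / d) * \<eta> powr (1 - \<alpha> / d))"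
    if [measurable]: "v \<in> borel_measurable borel" and vh: "\<And>y. v y \<le> h" and h: "h > 0" and eta: "\<eta> > 0"
      and m: "mass v \<le> ennreal \<eta>" for v :: "'a \<Rightarrow> real" and x h \<eta>
  proof -
    define t where "t = (\<eta> / h) powr (1 / d)"
    have t: "t > 0" using h eta by (simp add: t_def)
    have [measurable]: "ball (0::'a) t \<in> sets borel" by simp
    have pt: "riesz \<alpha> (x - y) * ennreal (v y) \<le> ennreal h * (riesz \<alpha> (x - y) * indicator (ball 0 t) (x - y)) + ennreal (t powr - \<alpha>) * ennreal (v y)" for y
    proof (cases "norm (x - y) < t")
      case True
      have "riesz \<alpha> (x - y) * ennreal (v y) \<le> riesz \<alpha> (x - y) * ennreal h"
        by (intro mult_left_mono ennreal_leI vh) auto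
      then show ?thesis using True by (simp add: mult.commute add_increasing2)
    next
      case False
      have "norm (x - y) powr - \<alpha> \<le> t powr - \<alpha>"
        using False t assms by (intro powr_mono2') auto
      then have "riesz \<alpha> (x - y) * ennreal (v y) \<le> ennreal (t powr - \<alpha>) * ennreal (v y)"
        unfolding riesz_def by (intro mult_right_mono ennreal_leI) auto
      then show ?thesis using False by (simp add: add_increasing)
    qed
    have "(\<integral>\<^sup>+y. riesz \<alpha> (x - y) * ennreal (v y) \<partial>lborel) \<le>
       (\<integral>\<^sup>+y. ennreal h * (riesz \<alpha> (x - y) * indicator (ball 0 t) (x - y)) + ennreal (t powr - \<alpha>) * ennreal (v y) \<partial>lborel)"
      by (intro nn_integral_mono pt)
    also have "\<dots> = ennreal h * (\<integral>\<^sup>+y. riesz \<alpha> (x - y) * indicator (ball 0 t) (x - y) \<partial>lborel) + ennreal (t powr - \<alpha>) * mass v"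
      unfolding mass_def by (subst nn_integral_add) (auto simp: nn_integral_cmult)
    also have "(\<integral>\<^sup>+y. riesz \<alpha> (x - y) * indicator (ball 0 t) (x - y) \<partial>lborel) = (\<integral>\<^sup>+z. riesz \<alpha> (z::'a) * indicator (ball 0 t) z \<partial>lborel)"
      by (rule nn_integral_lborel_diff[of "\<lambda>z. riesz \<alpha> z * indicator (ball 0 t) z"]) measurable
    also have "ennreal h * \<dots> + ennreal (t powr - \<alpha>) * mass v \<le> ennreal h * ennreal (C0 * t powr (d - \<alpha>)) + ennreal (t powr - \<alpha>) * ennreal \<eta>"
      by (intro add_mono mult_left_mono C0 t m) auto
    also have "\<dots> = ennreal (h * (C0 * t powr (d - \<alpha>)) + t powr - \<alpha> * \<eta>)"
      using h eta C0(1) by (simp add: ennreal_mult[symmetric] ennreal_plus[symmetric] del: ennreal_plus)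
    also have "h * (C0 * t powr (d - \<alpha>)) + t powr - \<alpha> * \<eta> = (C0 + 1) * h powr (\<alpha> / d) * \<eta> powr (1 - \<alpha> / d)"
    proof -
      define H K where "H = ln h" and "K = ln \<eta>"
      have hk: "h = exp H" "\<eta> = exp K" using h eta by (auto simp: H_def K_def)
      have te: "t = exp ((K - H) / d)" unfolding t_def hk by (simp add: powr_def exp_diff[symmetric])
      have 1: "h * (C0 * t powr (d - \<alpha>)) = C0 * h powr (\<alpha>/d) * \<eta> powr (1 - \<alpha>/d)"
      proof -
        have "H + (d - \<alpha>) * ((K - H) / d) = \<alpha> / d * H + (1 - \<alpha> / d) * K"
          using d by (simp add: field_simps)
        then have "exp H * exp ((d - \<alpha>) * ((K - H) / d)) = exp (\<alpha> / d * H) * exp ((1 - \<alpha> / d) * K)"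
          unfolding exp_add[symmetric] by simp
        then show ?thesis unfolding te hk powr_def by simp
      qed
      have 2: "t powr - \<alpha> * \<eta> = h powr (\<alpha>/d) * \<eta> powr (1 - \<alpha>/d)"
      proof -
        have "- \<alpha> * ((K - H) / d) + K = \<alpha> / d * H + (1 - \<alpha> / d) * K"
          using d by (simp add: field_simps)
        then have "exp (- \<alpha> * ((K - H) / d)) * exp K = exp (\<alpha> / d * H) * exp ((1 - \<alpha> / d) * K)"
          unfolding exp_add[symmetric] by simp
        then show ?thesis unfolding te hk powr_def by simp
      qed
      show ?thesis unfolding 1 2 by (simp add: algebra_simps)
    qed
    finally show ?thesis .
  qed
  show ?thesis
  proof (rule that)
    show "C0 + 1 > 0" using C0(1) by simp
  qed (rule main[unfolded d_def])
qed

text \<open>By symmetry only the pairs with \<open>u y \<le> u x\<close> matter, for which the inner integral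
  is a potential of a density bounded by \<open>u x\<close>.\<close>

lemma riesz_interaction_bound:
  assumes "0 < \<alpha>" "\<alpha> < real DIM('a::euclidean_space)"
  obtains C where "C > 0" "\<And>(u::'a \<Rightarrow> real) B \<eta>. u \<in> borel_measurable borel \<Longrightarrow> (\<And>x. 0 \<le> u x) \<Longrightarrow>
     B \<in> sets borel \<Longrightarrow> (\<And>z. - z \<in> B \<longleftrightarrow> z \<in> B) \<Longrightarrow> \<eta> > 0 \<Longrightarrow>
     (\<And>x. mass (\<lambda>y. u y * indicator B (x - y)) \<le> ennreal \<eta>) \<Longrightarrow>
     interaction (\<lambda>z. riesz \<alpha> z * indicator B z) u u
       \<le> ennreal (C * \<eta> powr (1 - \<alpha> / real DIM('a))) * power_mass (1 + \<alpha> / real DIM('a)) u"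
proof -
  let ?a = "\<alpha> / real DIM('a)"
  obtain C where C: "C > 0" "\<And>(v::'a \<Rightarrow> real) x h \<eta>. v \<in> borel_measurable borel \<Longrightarrow> (\<And>y. v y \<le> h) \<Longrightarrow>
     h > 0 \<Longrightarrow> \<eta> > 0 \<Longrightarrow> mass v \<le> ennreal \<eta> \<Longrightarrow>
     (\<integral>\<^sup>+y. riesz \<alpha> (x - y) * ennreal (v y) \<partial>lborel) \<le> ennreal (C * h powr ?a * \<eta> powr (1 - ?a))"
    using riesz_potential_bound[OF assms] by blast
  have main: "interaction (\<lambda>z. riesz \<alpha> z * indicator B z) u u \<le> ennreal (2 * C * \<eta> powr (1 - ?a)) * power_mass (1 + ?a) u"
    if [measurable]: "u \<in> borel_measurable borel" and u: "\<And>x. 0 \<le> u x" and [measurable]: "B \<in> sets borel"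
      and B: "\<And>z. - z \<in> B \<longleftrightarrow> z \<in> B" and eta: "\<eta> > 0"
      and m: "\<And>x. mass (\<lambda>y. u y * indicator B (x - y)) \<le> ennreal \<eta>" for u :: "'a \<Rightarrow> real" and B \<eta>
  proof -
    define v where "v x y = (if u y \<le> u x then u y * indicator B (x - y) else 0)" for x y
    define F where "F x y = ennreal (u x) * (riesz \<alpha> (x - y) * ennreal (v x y))" for x y
    have v_meas[measurable]: "(\<lambda>(x, y). v x y) \<in> borel_measurable (borel \<Otimes>\<^sub>M borel)"
      unfolding v_def by measurable
    have F_meas[measurable]: "(\<lambda>(x, y). F x y) \<in> borel_measurable (lborel \<Otimes>\<^sub>M lborel)"
      unfolding F_def by measurable
    have pt: "riesz \<alpha> (x - y) * indicator B (x - y) * (ennreal (u x) * ennreal (u y)) \<le> F x y + F y x" for x y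
    proof (cases "x - y \<in> B")
      case True
      then have "y - x \<in> B" using B[of "x - y"] by simp
      have "riesz \<alpha> (y - x) = riesz \<alpha> (x - y)" using riesz_minus[of \<alpha> "x - y"] by simp
      then show ?thesis using True \<open>y - x \<in> B\<close>
        by (cases "u y \<le> u x") (auto simp: F_def v_def mult_ac intro: add_increasing add_increasing2)
    qed simp
    have inner: "(\<integral>\<^sup>+y. F x y \<partial>lborel) \<le> ennreal (C * \<eta> powr (1 - ?a)) * ennreal (u x powr (1 + ?a))" for x
    proof (cases "u x = 0")
      case True then show ?thesis by (simp add: F_def)
    next
      case False
      then have ux: "u x > 0" using u[of x] by simp
      have [measurable]: "v x \<in> borel_measurable borel" unfolding v_def by measurable
      have "mass (v x) \<le> mass (\<lambda>y. u y * indicator B (x - y))"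
        unfolding mass_def by (intro nn_integral_mono ennreal_leI) (auto simp: v_def u)
      also have "\<dots> \<le> ennreal \<eta>" by (rule m)
      finally have mv: "mass (v x) \<le> ennreal \<eta>" .
      have "v x y \<le> u x" for y using u by (auto simp: v_def indicator_def)
      from C(2)[OF _ this ux eta mv, of x]
      have "(\<integral>\<^sup>+y. riesz \<alpha> (x - y) * ennreal (v x y) \<partial>lborel) \<le> ennreal (C * u x powr ?a * \<eta> powr (1 - ?a))" by simp
      then have "(\<integral>\<^sup>+y. F x y \<partial>lborel) \<le> ennreal (u x) * ennreal (C * u x powr ?a * \<eta> powr (1 - ?a))"
        unfolding F_def by (subst nn_integral_cmult) (auto intro!: mult_left_mono)
      also have "\<dots> = ennreal (C * \<eta> powr (1 - ?a)) * ennreal (u x powr (1 + ?a))"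
        using ux C(1) by (simp add: ennreal_mult[symmetric] powr_add mult_ac)
      finally show ?thesis .
    qed
    have "interaction (\<lambda>z. riesz \<alpha> z * indicator B z) u u \<le> (\<integral>\<^sup>+x. \<integral>\<^sup>+y. F x y + F y x \<partial>lborel \<partial>lborel)"
      unfolding interaction_def by (intro nn_integral_mono pt)
    also have "\<dots> = (\<integral>\<^sup>+x. \<integral>\<^sup>+y. F x y \<partial>lborel \<partial>lborel) + (\<integral>\<^sup>+x. \<integral>\<^sup>+y. F y x \<partial>lborel \<partial>lborel)"
      by (simp add: nn_integral_add)
    also have "(\<integral>\<^sup>+x. \<integral>\<^sup>+y. F y x \<partial>lborel \<partial>lborel) = (\<integral>\<^sup>+x. \<integral>\<^sup>+y. F x y \<partial>lborel \<partial>lborel)"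
      by (rule lborel_pair.Fubini'[of "\<lambda>x y. F x y"]) measurable
    also have "(\<integral>\<^sup>+x. \<integral>\<^sup>+y. F x y \<partial>lborel \<partial>lborel) + (\<integral>\<^sup>+x. \<integral>\<^sup>+y. F x y \<partial>lborel \<partial>lborel)
       = 2 * (\<integral>\<^sup>+x. \<integral>\<^sup>+y. F x y \<partial>lborel \<partial>lborel)" by (simp add: mult_2)
    also have "\<dots> \<le> 2 * (\<integral>\<^sup>+x. ennreal (C * \<eta> powr (1 - ?a)) * ennreal (u x powr (1 + ?a)) \<partial>lborel)"
      by (intro mult_left_mono nn_integral_mono inner) auto
    also have "\<dots> = 2 * (ennreal (C * \<eta> powr (1 - ?a)) * power_mass (1 + ?a) u)"
      unfolding power_mass_def by (subst nn_integral_cmult) auto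
    also have "\<dots> = ennreal (2 * C * \<eta> powr (1 - ?a)) * power_mass (1 + ?a) u"
      using C(1) by (simp add: ennreal_mult mult.assoc)
    finally show ?thesis .
  qed
  show ?thesis
  proof (rule that)
    show "2 * C > 0" using C(1) by simp
  qed (rule main)
qed

section \<open>Elementary rules for interactions\<close>

lemma interaction_mono:
  assumes "\<And>z. k z \<le> k' z"
  shows "interaction k u v \<le> interaction k' u v"
  unfolding interaction_def by (intro nn_integral_mono mult_right_mono assms) auto

lemma interaction_const:
  assumes [measurable]: "u \<in> borel_measurable borel" "v \<in> borel_measurable borel"
  shows "interaction (\<lambda>_. c) u v = c * (mass u * mass v)"
  unfolding interaction_def mass_def by (simp add: nn_integral_cmult nn_integral_multc)

lemma interaction_add_kernel:
  assumes [measurable]: "k \<in> borel_measurable borel" "k' \<in> borel_measurable borel"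
    "u \<in> borel_measurable borel" "v \<in> borel_measurable borel"
  shows "interaction (\<lambda>z. k z + k' z) u v = interaction k u v + interaction k' u v"
proof -
  have "interaction (\<lambda>z. k z + k' z) u v = (\<integral>\<^sup>+x. (\<integral>\<^sup>+y. k (x - y) * (ennreal (u x) * ennreal (v y)) \<partial>lborel)
      + (\<integral>\<^sup>+y. k' (x - y) * (ennreal (u x) * ennreal (v y)) \<partial>lborel) \<partial>lborel)"
    unfolding interaction_def distrib_right by (intro nn_integral_cong nn_integral_add) measurable
  also have "\<dots> = interaction k u v + interaction k' u v"
    unfolding interaction_def by (intro nn_integral_add) measurable
  finally show ?thesis .
qed

lemma riesz_far_le:
  assumes "r > 0" "\<alpha> > 0"
  shows "riesz \<alpha> z * indicator (- ball 0 r) z \<le> ennreal (r powr - \<alpha>)"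
proof (cases "norm z < r")
  case False
  then have "norm z powr - \<alpha> \<le> r powr - \<alpha>" using assms by (intro powr_mono2') auto
  then show ?thesis using False by (simp add: riesz_def ennreal_leI)
qed simp

lemma riesz_near_far_split:
  assumes [measurable]: "u \<in> borel_measurable borel" "v \<in> borel_measurable borel"
  shows "interaction (riesz \<alpha>) u v = interaction (\<lambda>z. riesz \<alpha> z * indicator (ball 0 r) z) u v
    + interaction (\<lambda>z. riesz \<alpha> z * indicator (- ball 0 r) z) u v"
proof -
  have [measurable]: "ball (0::'a) r \<in> sets borel" by simp
  have "riesz \<alpha> = (\<lambda>z::'a. riesz \<alpha> z * indicator (ball 0 r) z + riesz \<alpha> z * indicator (- ball 0 r) z)"
    by (auto simp: fun_eq_iff indicator_def)
  then have "interaction (riesz \<alpha>) u v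
      = interaction (\<lambda>z. riesz \<alpha> z * indicator (ball 0 r) z + riesz \<alpha> z * indicator (- ball 0 r) z) u v"
    by (rule arg_cong)
  also have "\<dots> = interaction (\<lambda>z. riesz \<alpha> z * indicator (ball 0 r) z) u v
    + interaction (\<lambda>z. riesz \<alpha> z * indicator (- ball 0 r) z) u v"
    by (intro interaction_add_kernel) measurable
  finally show ?thesis .
qed

text \<open>With \<open>\<kappa> = \<alpha> \<epsilon> / (m - 1)\<close> the energy times \<open>\<alpha>\<close> is \<open>\<kappa> P(u) - W(u)\<close>, so minimising the energy means
  maximising \<open>W - \<kappa> P\<close>.\<close>

locale aggregation_diffusion =
  fixes \<alpha> m a \<kappa> :: real and dom :: "'a::euclidean_space itself"
  assumes alpha_pos: "0 < \<alpha>" and alpha_dim: "\<alpha> < real DIM('a)"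
    and a_def: "a = \<alpha> / real DIM('a)"
    and m_gt_1: "1 < m" and kappa_pos: "0 < \<kappa>" and alpha_m: "\<alpha> < (m - 1) * real DIM('a)"
begin

text \<open>\<open>a < 1\<close> expresses local integrability of the kernel;
  \<open>a < m - 1\<close> says that the exponent \<open>1 + a\<close> of the bathtub estimate lies
  strictly below the diffusion exponent \<open>m\<close>.\<close>

lemma a_bounds: "0 < a" "a < 1" "a < m - 1"
  using alpha_pos alpha_dim alpha_m by (auto simp: a_def field_simps)

section \<open>A priori bounds in terms of mass and power mass\<close>

abbreviation W :: "('a \<Rightarrow> real) \<Rightarrow> ennreal" where "W u \<equiv> interaction (riesz \<alpha>) u u"

abbreviation near :: "real \<Rightarrow> ('a \<Rightarrow> real) \<Rightarrow> ennreal" where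
  "near r u \<equiv> interaction (\<lambda>z. riesz \<alpha> z * indicator (ball 0 r) z) u u"

text \<open>Mass at most 1 instead of exactly 1: the class has to contain the pieces into which a
  density is cut.\<close>

definition subdensity :: "('a \<Rightarrow> real) \<Rightarrow> bool" where
  "subdensity u \<longleftrightarrow> u \<in> borel_measurable borel \<and> (\<forall>x. 0 \<le> u x) \<and> mass u \<le> 1 \<and> power_mass m u < \<infinity>"

lemma subdensityD:
  assumes "subdensity u"
  shows "u \<in> borel_measurable borel" "0 \<le> u x" "mass u \<le> 1" "power_mass m u < \<infinity>"
  using assms by (auto simp: subdensity_def)

text \<open>Where \<open>u x \<le> T\<close> the factor \<open>u x powr a\<close> is bounded by its
  value at \<open>T\<close>; above \<open>T\<close> the same is done with the negative power
  \<open>- (m - 1 - a)\<close>. A large \<open>T\<close> makes the coefficient of the power mass as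
  small as desired.\<close>

lemma power_mass_interpolation:
  assumes T: "T > 0" and [measurable]: "u \<in> borel_measurable borel" and u: "\<And>x. 0 \<le> u x"
  shows "power_mass (1 + a) (u :: 'a \<Rightarrow> real)
    \<le> ennreal (T powr a) * mass u + ennreal (T powr (- (m - 1 - a))) * power_mass m u"
proof -
  have "u x powr (1 + a) \<le> T powr a * u x + T powr (- (m - 1 - a)) * u x powr m" for x
  proof (cases "u x = 0")
    case False
    then have ux: "u x > 0" using u[of x] by simp
    show ?thesis
    proof (cases "u x \<le> T")
      case True
      have "u x powr (1 + a) = u x powr a * u x" using ux by (simp add: powr_add)
      also have "\<dots> \<le> T powr a * u x" using True ux a_bounds by (intro mult_right_mono powr_mono2) auto
      finally show ?thesis by (simp add: add_increasing2)
    next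
      case False
      have "u x powr (1 + a) = u x powr (- (m - 1 - a)) * u x powr m" using ux by (simp add: powr_add[symmetric] add.commute)
      also have "\<dots> \<le> T powr (- (m - 1 - a)) * u x powr m"
        using False T a_bounds by (intro mult_right_mono powr_mono2') auto
      finally show ?thesis using ux by (simp add: add_increasing)
    qed
  qed simp
  then have "power_mass (1 + a) u \<le> (\<integral>\<^sup>+x. ennreal (T powr a * u x + T powr (- (m - 1 - a)) * u x powr m) \<partial>lborel)"
    unfolding power_mass_def by (intro nn_integral_mono ennreal_leI)
  also have "\<dots> = (\<integral>\<^sup>+x. ennreal (T powr a) * ennreal (u x) + ennreal (T powr (- (m - 1 - a))) * ennreal (u x powr m) \<partial>lborel)"
    using u by (simp add: ennreal_mult)
  also have "\<dots> = ennreal (T powr a) * mass u + ennreal (T powr (- (m - 1 - a))) * power_mass m u"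
    unfolding mass_def power_mass_def by (subst nn_integral_add) (auto simp: nn_integral_cmult)
  finally show ?thesis .
qed

text \<open>Uniform integrability from a bound on the power mass: the part of \<open>u\<close> below
  height \<open>L\<close> is controlled by volume, the part above it by a Chebyshev
  estimate.\<close>

lemma mass_on_set_le:
  assumes L: "L > 0" and [measurable]: "u \<in> borel_measurable borel" "A \<in> sets borel" and u: "\<And>x. 0 \<le> u x"
  shows "mass (\<lambda>x. u x * indicator A x)
    \<le> ennreal L * emeasure lborel (A :: 'a set) + ennreal (L powr (1 - m)) * power_mass m u"
proof -
  have pt: "u x * indicator A x \<le> L * indicator A x + L powr (1 - m) * u x powr m" for x
  proof (cases "u x \<le> L")
    case True
    then show ?thesis using L by (auto simp: indicator_def add_increasing2)
  next
    case False
    then have ux: "u x > 0" using L by simp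
    have "u x = u x powr (1 - m) * u x powr m" using ux by (simp add: powr_add[symmetric])
    also have "\<dots> \<le> L powr (1 - m) * u x powr m"
      using False L m_gt_1 by (intro mult_right_mono powr_mono2') auto
    finally show ?thesis using L by (auto simp: indicator_def)
  qed
  have "mass (\<lambda>x. u x * indicator A x) \<le> (\<integral>\<^sup>+x. ennreal (L * indicator A x + L powr (1 - m) * u x powr m) \<partial>lborel)"
    unfolding mass_def by (intro nn_integral_mono ennreal_leI pt)
  also have "\<dots> = (\<integral>\<^sup>+x. ennreal L * indicator A x + ennreal (L powr (1 - m)) * ennreal (u x powr m) \<partial>lborel)"
    using u L by (intro nn_integral_cong) (auto simp: ennreal_mult indicator_def)
  also have "\<dots> = ennreal L * emeasure lborel A + ennreal (L powr (1 - m)) * power_mass m u"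
    unfolding power_mass_def by (subst nn_integral_add) (auto simp: nn_integral_cmult nn_integral_cmult_indicator)
  finally show ?thesis .
qed

text \<open>The gain is the positive power \<open>1 - a\<close> of \<eta>. It is exploited in two
  regimes: for small radii, where all balls carry little mass, and for a fixed radius when the
  density is spread thin.\<close>

lemma near_bound:
  obtains C where "C > 0" "\<And>u r \<eta>. subdensity u \<Longrightarrow> \<eta> > 0 \<Longrightarrow>
    (\<And>x. mass (\<lambda>y. u y * indicator (ball x r) y) \<le> ennreal \<eta>) \<Longrightarrow>
    near r u \<le> ennreal (C * \<eta> powr (1 - a)) * (1 + power_mass m u)"
proof -
  obtain C where C: "C > 0" "\<And>(u::'a \<Rightarrow> real) B \<eta>. u \<in> borel_measurable borel \<Longrightarrow> (\<And>x. 0 \<le> u x) \<Longrightarrow>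
     B \<in> sets borel \<Longrightarrow> (\<And>z. - z \<in> B \<longleftrightarrow> z \<in> B) \<Longrightarrow> \<eta> > 0 \<Longrightarrow>
     (\<And>x. mass (\<lambda>y. u y * indicator B (x - y)) \<le> ennreal \<eta>) \<Longrightarrow>
     interaction (\<lambda>z. riesz \<alpha> z * indicator B z) u u
       \<le> ennreal (C * \<eta> powr (1 - a)) * power_mass (1 + a) u"
    using riesz_interaction_bound[OF alpha_pos alpha_dim, folded a_def] by blast
  have main: "near r u \<le> ennreal (C * \<eta> powr (1 - a)) * (1 + power_mass m u)"
    if u: "subdensity u" and eta: "\<eta> > 0"
      and ma: "\<And>x. mass (\<lambda>y. u y * indicator (ball x r) y) \<le> ennreal \<eta>" for u r \<eta>
  proof -
    note [measurable] = subdensityD(1)[OF u]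
    have eq: "indicator (ball 0 r) (x - y) = (indicator (ball x r) y :: real)" for x y :: 'a
      by (auto simp: indicator_def dist_norm norm_minus_commute)
    have "near r u \<le> ennreal (C * \<eta> powr (1 - a)) * power_mass (1 + a) u"
      by (rule C(2)) (use subdensityD[OF u] eta ma in \<open>auto simp: eq\<close>)
    \<comment> \<open>The threshold \<open>T = 1\<close> suffices, since only boundedness by
      \<open>1 + power_mass m u\<close> is wanted here; the smallness comes from \<eta>.\<close>
    also have "power_mass (1 + a) u \<le> ennreal (1 powr a) * mass u + ennreal (1 powr (- (m - 1 - a))) * power_mass m u"
      by (rule power_mass_interpolation) (use subdensityD[OF u] in auto)
    also have "\<dots> \<le> 1 + power_mass m u"
      using subdensityD(3)[OF u] by (simp add: add_right_mono)
    finally show ?thesis by (simp add: mult_left_mono)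
  qed
  show ?thesis by (rule that[OF C(1)]) (rule main)
qed

text \<open>By \<open>mass_on_set_le\<close> a bound on the power mass makes the mass of small balls
  small, uniformly in the density and the centre, and \<open>near_bound\<close> applies.\<close>

lemma near_uniformly_small:
  assumes "c \<ge> 0" "\<delta> > 0"
  obtains r where "r > 0" "\<And>u. subdensity u \<Longrightarrow> power_mass m u \<le> ennreal c \<Longrightarrow> near r u \<le> ennreal \<delta>"
proof -
  obtain C where C: "C > 0" "\<And>u r \<eta>. subdensity u \<Longrightarrow> \<eta> > 0 \<Longrightarrow>
    (\<And>x. mass (\<lambda>y. u y * indicator (ball x r) y) \<le> ennreal \<eta>) \<Longrightarrow>
    near r u \<le> ennreal (C * \<eta> powr (1 - a)) * (1 + power_mass m u)"
    using near_bound by blast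
  \<comment> \<open>\<eta> solves
    \<open>C * \<eta> powr (1 - a) * (1 + c) = \<delta>\<close>.\<close>
  define \<eta> where "\<eta> = (\<delta> / (C * (1 + c))) powr (1 / (1 - a))"
  have eta: "\<eta> > 0" using C(1) assms by (simp add: \<eta>_def)
  have eta_eq: "C * \<eta> powr (1 - a) * (1 + c) = \<delta>"
    unfolding \<eta>_def powr_powr using C(1) assms a_bounds by simp
  \<comment> \<open>\<open>L\<close> solves \<open>L powr (1 - m) * (c + 1) = \<eta> / 2\<close>,
    leaving \<eta>/2 for the volume term; \<open>c + 1\<close> in place of \<open>c\<close> keeps it
    positive when \<open>c = 0\<close>.\<close>
  define L where "L = ((c + 1) * 2 / \<eta>) powr (1 / (m - 1))"
  have L: "L > 0" using eta assms by (simp add: L_def)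
  have "L powr (1 - m) = ((c + 1) * 2 / \<eta>) powr - 1"
  proof -
    have "1 / (m - 1) * (1 - m) = -1" using m_gt_1 by (simp add: divide_simps)
    then show ?thesis unfolding L_def powr_powr by (simp only:)
  qed
  then have "L powr (1 - m) = \<eta> / ((c + 1) * 2)"
    using eta assms by (simp add: powr_minus_divide)
  moreover have "c + 1 \<noteq> 0" using assms by simp
  ultimately have "L powr (1 - m) * (c + 1) = \<eta> / 2"
    by (simp add: divide_simps) (simp add: algebra_simps)
  then have L_eq: "L powr (1 - m) * c \<le> \<eta> / 2"
    by (metis L add.commute add_increasing assms(1) le_add_same_cancel2 less_eq_real_def mult_left_mono powr_ge_zero zero_le_one)
  have "((\<lambda>r::real. L * (unit_ball_vol (real DIM('a)) * r ^ DIM('a))) \<longlongrightarrow> L * (unit_ball_vol (real DIM('a)) * 0 ^ DIM('a))) (at_right 0)"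
    by (intro tendsto_intros)
  then have "((\<lambda>r::real. L * (unit_ball_vol (real DIM('a)) * r ^ DIM('a))) \<longlongrightarrow> 0) (at_right 0)"
    by (simp only: zero_power[OF DIM_positive] mult_zero_right)
  then have "\<forall>\<^sub>F r in at_right 0. L * (unit_ball_vol (real DIM('a)) * r ^ DIM('a)) < \<eta> / 2"
    using eta by (intro order_tendstoD) auto
  moreover have "\<forall>\<^sub>F r in at_right (0::real). r > 0" by (simp add: eventually_at_right_less)
  ultimately have "\<forall>\<^sub>F r in at_right 0. r > 0 \<and> L * (unit_ball_vol (real DIM('a)) * r ^ DIM('a)) < \<eta> / 2"
    by (rule eventually_conj[rotated])
  then obtain r where r: "r > 0" "L * (unit_ball_vol (real DIM('a)) * r ^ DIM('a)) < \<eta> / 2"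
    using eventually_happens'[OF trivial_limit_at_right_real] by blast
  have "near r u \<le> ennreal \<delta>" if u: "subdensity u" and P: "power_mass m u \<le> ennreal c" for u
  proof -
    have "mass (\<lambda>y. u y * indicator (ball x r) y) \<le> ennreal \<eta>" for x
    proof -
      have "mass (\<lambda>y. u y * indicator (ball x r) y)
          \<le> ennreal L * emeasure lborel (ball x r) + ennreal (L powr (1 - m)) * power_mass m u"
        by (rule mass_on_set_le) (use subdensityD[OF u] L in auto)
      also have "\<dots> \<le> ennreal L * ennreal (unit_ball_vol (real DIM('a)) * r ^ DIM('a)) + ennreal (L powr (1 - m)) * ennreal c"
        using r by (intro add_mono mult_left_mono P) (auto simp: emeasure_ball)
      also have "\<dots> = ennreal (L * (unit_ball_vol (real DIM('a)) * r ^ DIM('a)) + L powr (1 - m) * c)"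
        using L r assms by (simp add: ennreal_mult)
      also have "\<dots> \<le> ennreal \<eta>" using r(2) L_eq by (intro ennreal_leI) linarith
      finally show ?thesis .
    qed
    then have "near r u \<le> ennreal (C * \<eta> powr (1 - a)) * (1 + power_mass m u)"
      by (intro C(2) u eta)
    also have "\<dots> \<le> ennreal (C * \<eta> powr (1 - a)) * (1 + ennreal c)"
      by (intro mult_left_mono add_left_mono P) auto
    also have "\<dots> = ennreal (C * \<eta> powr (1 - a) * (1 + c))"
      using C(1) assms by (simp add: ennreal_mult ennreal_plus[symmetric] ennreal_1[symmetric] del: ennreal_plus ennreal_1)
    finally show ?thesis unfolding eta_eq .
  qed
  then show ?thesis using that r(1) by blast
qed

lemma coercive:
  assumes "\<theta> > 0"
  obtains K where "K \<ge> 0" "\<And>u. subdensity u \<Longrightarrow> W u \<le> ennreal \<theta> * power_mass m u + ennreal K"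
proof -
  obtain C where C: "C > 0" "\<And>(u::'a \<Rightarrow> real) B \<eta>. u \<in> borel_measurable borel \<Longrightarrow> (\<And>x. 0 \<le> u x) \<Longrightarrow>
     B \<in> sets borel \<Longrightarrow> (\<And>z. - z \<in> B \<longleftrightarrow> z \<in> B) \<Longrightarrow> \<eta> > 0 \<Longrightarrow>
     (\<And>x. mass (\<lambda>y. u y * indicator B (x - y)) \<le> ennreal \<eta>) \<Longrightarrow>
     interaction (\<lambda>z. riesz \<alpha> z * indicator B z) u u
       \<le> ennreal (C * \<eta> powr (1 - a)) * power_mass (1 + a) u"
    using riesz_interaction_bound[OF alpha_pos alpha_dim, folded a_def] by blast
  \<comment> \<open>\<open>T\<close> is chosen so that \<theta> becomes the coefficient of the power
    mass; this can be solved for every \<theta> because \<open>a < m - 1\<close>.\<close>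
  define T where "T = (\<theta> / C) powr (- 1 / (m - 1 - a))"
  have T: "T > 0" using assms C(1) by (simp add: T_def)
  have T_eq: "C * T powr (- (m - 1 - a)) = \<theta>"
  proof -
    have "- 1 / (m - 1 - a) * (- (m - 1 - a)) = 1" using a_bounds by (simp add: divide_simps)
    then have "T powr (- (m - 1 - a)) = \<theta> / C"
      unfolding T_def powr_powr using C(1) assms by simp
    then show ?thesis using C(1) by simp
  qed
  have "W u \<le> ennreal \<theta> * power_mass m u + ennreal (C * T powr a)" if u: "subdensity u" for u
  proof -
    \<comment> \<open>With \<open>B = UNIV\<close> and \<eta> = 1 the local mass condition is just
      \<open>mass u \<le> 1\<close>.\<close>
    have "interaction (\<lambda>z. riesz \<alpha> z * indicator UNIV z) u u \<le> ennreal (C * 1 powr (1 - a)) * power_mass (1 + a) u"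
      by (rule C(2)) (use subdensityD[OF u] in auto)
    then have "W u \<le> ennreal C * power_mass (1 + a) u" by simp
    also have "\<dots> \<le> ennreal C * (ennreal (T powr a) * mass u + ennreal (T powr (- (m - 1 - a))) * power_mass m u)"
      by (intro mult_left_mono power_mass_interpolation T subdensityD[OF u]) auto
    also have "\<dots> \<le> ennreal C * (ennreal (T powr a) * 1 + ennreal (T powr (- (m - 1 - a))) * power_mass m u)"
      by (intro mult_left_mono add_right_mono subdensityD[OF u]) auto
    also have "\<dots> = ennreal (C * T powr (- (m - 1 - a))) * power_mass m u + ennreal (C * T powr a)"
      using C(1) by (simp add: ennreal_mult distrib_left mult.assoc add.commute)
    finally show ?thesis unfolding T_eq .
  qed
  then show ?thesis using that[of "C * T powr a"] C(1) by auto
qed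

text \<open>Used in contrapositive form: a density with substantial interaction has a ball of a
  fixed radius with a fixed amount of mass. Pairs at distance at least \<open>R\<close> contribute
  at most \<open>R powr - \<alpha> = \<omega> / 2\<close>, and the closer ones are handled by
  \<open>near_bound\<close>.\<close>

lemma nonvanishing:
  assumes "c \<ge> 0" "\<omega> > 0"
  obtains R \<eta> where "R > 0" "\<eta> > 0" "\<And>u. subdensity u \<Longrightarrow> power_mass m u \<le> ennreal c \<Longrightarrow>
    (\<And>x. mass (\<lambda>y. u y * indicator (ball x R) y) \<le> ennreal \<eta>) \<Longrightarrow> W u \<le> ennreal \<omega>"
proof -
  obtain C where C: "C > 0" "\<And>u r \<eta>. subdensity u \<Longrightarrow> \<eta> > 0 \<Longrightarrow>
    (\<And>x. mass (\<lambda>y. u y * indicator (ball x r) y) \<le> ennreal \<eta>) \<Longrightarrow>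
    near r u \<le> ennreal (C * \<eta> powr (1 - a)) * (1 + power_mass m u)"
    using near_bound by blast
  define R where "R = (\<omega> / 2) powr (- 1 / \<alpha>)"
  have R: "R > 0" "R powr - \<alpha> = \<omega> / 2"
    using assms alpha_pos by (auto simp: R_def powr_powr)
  define \<eta> where "\<eta> = (\<omega> / (2 * (C * (1 + c)))) powr (1 / (1 - a))"
  have eta: "\<eta> > 0" using C(1) assms by (simp add: \<eta>_def)
  have eta_eq: "C * \<eta> powr (1 - a) * (1 + c) = \<omega> / 2"
  proof -
    have "\<eta> powr (1 - a) = \<omega> / (2 * (C * (1 + c)))"
      unfolding \<eta>_def powr_powr using C(1) assms a_bounds by simp
    moreover have "1 + c \<noteq> 0" using assms by simp
    ultimately show ?thesis using C(1) by (simp add: divide_simps) (simp add: algebra_simps)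
  qed
  have "W u \<le> ennreal \<omega>" if u: "subdensity u" and P: "power_mass m u \<le> ennreal c"
    and ma: "\<And>x. mass (\<lambda>y. u y * indicator (ball x R) y) \<le> ennreal \<eta>" for u
  proof -
    note [measurable] = subdensityD(1)[OF u]
    have "near R u \<le> ennreal (C * \<eta> powr (1 - a)) * (1 + power_mass m u)"
      by (intro C(2) u eta ma)
    also have "\<dots> \<le> ennreal (C * \<eta> powr (1 - a)) * (1 + ennreal c)"
      by (intro mult_left_mono add_left_mono P) auto
    also have "\<dots> = ennreal (C * \<eta> powr (1 - a) * (1 + c))"
      using C(1) assms by (simp add: ennreal_mult ennreal_plus[symmetric] ennreal_1[symmetric] del: ennreal_plus ennreal_1)
    finally have 1: "near R u \<le> ennreal (\<omega> / 2)" unfolding eta_eq .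
    have "interaction (\<lambda>z. riesz \<alpha> z * indicator (- ball 0 R) z) u u \<le> interaction (\<lambda>_. ennreal (R powr - \<alpha>)) u u"
      by (intro interaction_mono riesz_far_le R alpha_pos)
    also have "\<dots> = ennreal (\<omega> / 2) * (mass u * mass u)"
      by (subst interaction_const) (auto simp: R)
    also have "\<dots> \<le> ennreal (\<omega> / 2) * (1 * 1)"
      by (intro mult_mono subdensityD[OF u]) auto
    finally have 2: "interaction (\<lambda>z. riesz \<alpha> z * indicator (- ball 0 R) z) u u \<le> ennreal (\<omega> / 2)" by simp
    have "W u \<le> ennreal (\<omega> / 2) + ennreal (\<omega> / 2)"
      unfolding riesz_near_far_split[OF subdensityD(1)[OF u] subdensityD(1)[OF u], of \<alpha> R]
      by (intro add_mono 1 2)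
    also have "\<dots> = ennreal \<omega>" using assms by (simp add: ennreal_plus[symmetric] del: ennreal_plus)
    finally show ?thesis .
  qed
  then show ?thesis using that R(1) eta by blast
qed

end

section \<open>Scaling\<close>

lemma nn_integral_lborel_scale:
  fixes f :: "'a::euclidean_space \<Rightarrow> ennreal"
  assumes "f \<in> borel_measurable borel" and l: "l > 0"
  shows "(\<integral>\<^sup>+x. f (l *\<^sub>R x) \<partial>lborel) = ennreal (l powr - real DIM('a)) * (\<integral>\<^sup>+x. f x \<partial>lborel)"
proof -
  have e: "l powr - real DIM('a) * l ^ DIM('a) = 1"
    using l by (simp add: powr_realpow[symmetric] powr_minus)
  have "ennreal (l powr - real DIM('a)) * (\<integral>\<^sup>+x. f x \<partial>lborel)
     = ennreal (l powr - real DIM('a)) * (ennreal (l ^ DIM('a)) * (\<integral>\<^sup>+x. f (l *\<^sub>R x) \<partial>lborel))"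
    using nn_integral_lborel_affine[OF assms(1), of l 0] l by simp
  also have "\<dots> = (\<integral>\<^sup>+x. f (l *\<^sub>R x) \<partial>lborel)"
    using l by (simp add: mult.assoc[symmetric] ennreal_mult[symmetric] e)
  finally show ?thesis by simp
qed

lemma nn_integral_lborel_shift:
  fixes f :: "'a::euclidean_space \<Rightarrow> ennreal"
  assumes "f \<in> borel_measurable borel"
  shows "(\<integral>\<^sup>+x. f (t + x) \<partial>lborel) = (\<integral>\<^sup>+x. f x \<partial>lborel)"
  using nn_integral_lborel_affine[OF assms, of 1 t] by simp

lemma interaction_shift:
  assumes [measurable]: "k \<in> borel_measurable borel" "u \<in> borel_measurable borel"
  shows "interaction k (\<lambda>x. u (t + x)) (\<lambda>x. u (t + x)) = interaction k u u"
proof -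
  have "interaction k (\<lambda>x. u (t + x)) (\<lambda>x. u (t + x))
      = (\<integral>\<^sup>+x. \<integral>\<^sup>+y. k ((t + x) - (t + y)) * (ennreal (u (t + x)) * ennreal (u (t + y))) \<partial>lborel \<partial>lborel)"
    by (simp add: interaction_def)
  also have "\<dots> = (\<integral>\<^sup>+x. \<integral>\<^sup>+y. k ((t + x) - y) * (ennreal (u (t + x)) * ennreal (u y)) \<partial>lborel \<partial>lborel)"
    by (intro nn_integral_cong nn_integral_lborel_shift) measurable
  also have "\<dots> = interaction k u u" unfolding interaction_def
    by (rule nn_integral_lborel_shift[of "\<lambda>x. \<integral>\<^sup>+y. k (x - y) * (ennreal (u x) * ennreal (u y)) \<partial>lborel"]) measurable
  finally show ?thesis .
qed

lemma interaction_riesz_scale: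
  fixes u :: "'a::euclidean_space \<Rightarrow> real"
  assumes [measurable]: "u \<in> borel_measurable borel" and u: "\<And>x. 0 \<le> u x" and b: "b > 0" and l: "l > 0"
  shows "interaction (riesz \<alpha>) (\<lambda>x. b * u (l *\<^sub>R x)) (\<lambda>x. b * u (l *\<^sub>R x))
    = ennreal (b\<^sup>2 * l powr (\<alpha> - 2 * real DIM('a))) * interaction (riesz \<alpha>) u u"
proof -
  define h where "h x y = riesz \<alpha> (x - y) * (ennreal (u x) * ennreal (u y))" for x y
  have [measurable]: "(\<lambda>(x, y). h x y) \<in> borel_measurable (borel \<Otimes>\<^sub>M borel)"
    unfolding h_def by measurable
  let ?c = "ennreal (b\<^sup>2 * l powr \<alpha>)" and ?l = "ennreal (l powr - real DIM('a))"
  have pt: "riesz \<alpha> (x - y) * (ennreal (b * u (l *\<^sub>R x)) * ennreal (b * u (l *\<^sub>R y)))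
      = ?c * h (l *\<^sub>R x) (l *\<^sub>R y)" for x y
  proof -
    have "norm (l *\<^sub>R x - l *\<^sub>R y) = l * norm (x - y)" using l by (simp add: scaleR_diff_right[symmetric])
    then have "norm (x - y) powr - \<alpha> = l powr \<alpha> * norm (l *\<^sub>R x - l *\<^sub>R y) powr - \<alpha>"
      using l by (simp add: powr_mult powr_minus)
    then have "norm (x - y) powr - \<alpha> * (b * u (l *\<^sub>R x) * (b * u (l *\<^sub>R y)))
        = b\<^sup>2 * l powr \<alpha> * (norm (l *\<^sub>R x - l *\<^sub>R y) powr - \<alpha> * (u (l *\<^sub>R x) * u (l *\<^sub>R y)))"
      by (simp add: power2_eq_square mult_ac)
    then show ?thesis
      unfolding riesz_def h_def using u b by (simp add: ennreal_mult[symmetric])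
  qed
  have "interaction (riesz \<alpha>) (\<lambda>x. b * u (l *\<^sub>R x)) (\<lambda>x. b * u (l *\<^sub>R x))
      = (\<integral>\<^sup>+x. \<integral>\<^sup>+y. ?c * h (l *\<^sub>R x) (l *\<^sub>R y) \<partial>lborel \<partial>lborel)"
    unfolding interaction_def pt ..
  also have "\<dots> = (\<integral>\<^sup>+x. ?c * (\<integral>\<^sup>+y. h (l *\<^sub>R x) (l *\<^sub>R y) \<partial>lborel) \<partial>lborel)"
    by (intro nn_integral_cong nn_integral_cmult) measurable
  also have "\<dots> = ?c * (\<integral>\<^sup>+x. \<integral>\<^sup>+y. h (l *\<^sub>R x) (l *\<^sub>R y) \<partial>lborel \<partial>lborel)"
    by (intro nn_integral_cmult) measurable
  also have "(\<integral>\<^sup>+x. \<integral>\<^sup>+y. h (l *\<^sub>R x) (l *\<^sub>R y) \<partial>lborel \<partial>lborel) = (\<integral>\<^sup>+x. ?l * (\<integral>\<^sup>+y. h (l *\<^sub>R x) y \<partial>lborel) \<partial>lborel)"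
    by (intro nn_integral_cong nn_integral_lborel_scale l) measurable
  also have "\<dots> = ?l * (\<integral>\<^sup>+x. \<integral>\<^sup>+y. h (l *\<^sub>R x) y \<partial>lborel \<partial>lborel)"
    by (intro nn_integral_cmult) measurable
  also have "(\<integral>\<^sup>+x. \<integral>\<^sup>+y. h (l *\<^sub>R x) y \<partial>lborel \<partial>lborel) = ?l * (\<integral>\<^sup>+x. \<integral>\<^sup>+y. h x y \<partial>lborel \<partial>lborel)"
    by (intro nn_integral_lborel_scale[of "\<lambda>x. \<integral>\<^sup>+y. h x y \<partial>lborel"] l) measurable
  also have "(\<integral>\<^sup>+x. \<integral>\<^sup>+y. h x y \<partial>lborel \<partial>lborel) = interaction (riesz \<alpha>) u u"
    unfolding interaction_def h_def ..
  also have "?c * (?l * (?l * interaction (riesz \<alpha>) u u)) = ennreal (b\<^sup>2 * l powr \<alpha> * (l powr - real DIM('a) * l powr - real DIM('a))) * interaction (riesz \<alpha>) u u"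
    by (simp add: ennreal_mult mult.assoc)
  also have "b\<^sup>2 * l powr \<alpha> * (l powr - real DIM('a) * l powr - real DIM('a)) = b\<^sup>2 * l powr (\<alpha> - 2 * real DIM('a))"
    by (simp add: powr_add[symmetric] mult.assoc)
  finally show ?thesis .
qed

lemma interaction_riesz_lower:
  fixes u :: "'a::euclidean_space \<Rightarrow> real"
  assumes [measurable]: "u \<in> borel_measurable borel" and u: "\<And>x. x \<notin> ball 0 1 \<Longrightarrow> u x = 0" and "\<alpha> > 0"
  shows "ennreal (2 powr - \<alpha>) * (mass u * mass u) \<le> interaction (riesz \<alpha>) u u"
proof -
  have "ennreal (2 powr - \<alpha>) * (mass u * mass u) = interaction (\<lambda>_. ennreal (2 powr - \<alpha>)) u u"
    by (simp add: interaction_const)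
  also have "\<dots> \<le> interaction (riesz \<alpha>) u u"
    unfolding interaction_def
  proof (rule nn_integral_mono, rule nn_integral_mono_AE)
    fix x :: 'a
    \<comment> \<open>The diagonal has to be excluded: there \<open>riesz\<close> takes the value 0
      and the pointwise bound fails.\<close>
    have "AE y in lborel. y \<noteq> x" by (rule AE_lborel_singleton)
    then show "AE y in lborel. ennreal (2 powr - \<alpha>) * (ennreal (u x) * ennreal (u y))
        \<le> riesz \<alpha> (x - y) * (ennreal (u x) * ennreal (u y))"
    proof eventually_elim
      case (elim y)
      show ?case
      proof (cases "x \<in> ball 0 1 \<and> y \<in> ball 0 1")
        case True
        then have "norm (x - y) \<le> 2" using norm_triangle_ineq4[of x y] by simp
        then have "2 powr - \<alpha> \<le> norm (x - y) powr - \<alpha>" using elim assms(3) by (intro powr_mono2') auto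
        then show ?thesis unfolding riesz_def by (intro mult_right_mono ennreal_leI) auto
      qed (use u in auto)
    qed
  qed
  finally show ?thesis .
qed

lemma interaction_zero_mass:
  assumes [measurable]: "k \<in> borel_measurable borel" "u \<in> borel_measurable borel" "v \<in> borel_measurable borel"
    and "mass v = 0"
  shows "interaction k u v = 0"
proof -
  have "AE y in lborel. ennreal (v y) = 0"
    using assms(4) unfolding mass_def by (subst (asm) nn_integral_0_iff_AE) auto
  then have "(\<integral>\<^sup>+y. k (x - y) * (ennreal (u x) * ennreal (v y)) \<partial>lborel) = 0" for x
    by (subst nn_integral_0_iff_AE) (auto elim!: eventually_mono)
  then show ?thesis unfolding interaction_def by simp
qed

section \<open>The optimal value and its homogeneity in the mass\<close>

context aggregation_diffusion
begin

text \<open>\<open>enn2real\<close> sends infinity to 0, so \<open>Wr\<close> and \<open>Pr\<close>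
  carry their intended meaning on subdensities, where \<open>W_eq_Wr\<close> and
  \<open>power_mass_eq_Pr\<close> recover the extended values.\<close>

definition Wr :: "('a \<Rightarrow> real) \<Rightarrow> real" where "Wr u = enn2real (W u)"

definition Pr :: "('a \<Rightarrow> real) \<Rightarrow> real" where "Pr u = enn2real (power_mass m u)"

definition densities :: "('a \<Rightarrow> real) set" where "densities = {u. subdensity u \<and> mass u = 1}"

text \<open>This is -\<alpha> times the infimum of the energy. The real supremum is meaningful
  because of \<open>bdd_above_functional\<close> and the nonemptiness shown by
  \<open>densities_ball\<close>.\<close>

definition J :: real where "J = (SUP u\<in>densities. Wr u - \<kappa> * Pr u)"

lemma Wr_nonneg: "0 \<le> Wr u" and Pr_nonneg: "0 \<le> Pr u"
  by (simp_all add: Wr_def Pr_def)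

lemma power_mass_eq_Pr: "subdensity u \<Longrightarrow> power_mass m u = ennreal (Pr u)"
  by (simp add: Pr_def subdensity_def less_top)

lemma W_eq_Wr:
  assumes "subdensity u"
  shows "W u = ennreal (Wr u)"
proof -
  obtain K where "K \<ge> 0" "\<And>u. subdensity u \<Longrightarrow> W u \<le> ennreal 1 * power_mass m u + ennreal K"
    using coercive[of 1] by auto
  then have "W u \<le> power_mass m u + ennreal K" using assms by simp
  also have "\<dots> < \<infinity>" using assms by (simp add: subdensity_def)
  finally show ?thesis by (simp add: Wr_def)
qed

lemma coercive_real:
  assumes "\<theta> > 0"
  obtains K where "K \<ge> 0" "\<And>u. subdensity u \<Longrightarrow> Wr u \<le> \<theta> * Pr u + K"
proof -
  obtain K where K: "K \<ge> 0" "\<And>u. subdensity u \<Longrightarrow> W u \<le> ennreal \<theta> * power_mass m u + ennreal K"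
    using coercive[OF assms] by blast
  have "Wr u \<le> \<theta> * Pr u + K" if "subdensity u" for u
    using K(2)[OF that] K(1) assms Pr_nonneg[of u] unfolding W_eq_Wr[OF that] power_mass_eq_Pr[OF that]
    by (simp add: ennreal_mult[symmetric] ennreal_plus[symmetric] del: ennreal_plus)
  then show ?thesis using that K(1) by blast
qed

lemma bdd_above_functional: "bdd_above ((\<lambda>u. Wr u - \<kappa> * Pr u) ` densities)"
proof -
  obtain K where K: "\<And>u. subdensity u \<Longrightarrow> Wr u \<le> \<kappa> * Pr u + K"
    using coercive_real[OF kappa_pos] by blast
  show ?thesis
    by (rule bdd_aboveI2[where M=K]) (use K in \<open>auto simp: densities_def algebra_simps\<close>)
qed

lemma le_J:
  assumes "u \<in> densities"
  shows "Wr u \<le> \<kappa> * Pr u + J"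
proof -
  have "Wr u - \<kappa> * Pr u \<le> J"
    unfolding J_def using assms by (rule cSUP_upper[OF _ bdd_above_functional])
  then show ?thesis by simp
qed

text \<open>Normalising the mass leaves the dilation factor \<open>l\<close> free. W and P scale
  with the different powers \<alpha> and d (m - 1) of it, and this difference is used both for the
  homogeneity in \<open>M\<close> and for the sign of \<open>J\<close>.\<close>

lemma rescale_to_density:
  assumes u: "subdensity u" and M: "mass u = ennreal M" "M > 0" and l: "l > 0"
  defines "v \<equiv> \<lambda>x. l powr real DIM('a) / M * u (l *\<^sub>R x)"
  shows "v \<in> densities" "Pr v = M powr - m * l powr (real DIM('a) * (m - 1)) * Pr u"
    "Wr v = M powr - 2 * l powr \<alpha> * Wr u"
proof -
  define d where "d = real DIM('a)"
  define b where "b = l powr d / M"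
  have b: "b > 0" using l M by (simp add: b_def)
  note [measurable] = subdensityD(1)[OF u]
  have v: "v = (\<lambda>x. b * u (l *\<^sub>R x))" by (simp add: v_def b_def d_def)
  have v_meas: "v \<in> borel_measurable borel" unfolding v by measurable
  have v_nonneg: "0 \<le> v x" for x unfolding v using b subdensityD(2)[OF u] by simp
  have "mass v = (\<integral>\<^sup>+x. ennreal b * ennreal (u (l *\<^sub>R x)) \<partial>lborel)"
    unfolding mass_def v using b subdensityD(2)[OF u] by (simp add: ennreal_mult)
  also have "\<dots> = ennreal b * (ennreal (l powr - d) * mass u)"
    unfolding mass_def d_def by (subst nn_integral_cmult) (auto simp: nn_integral_lborel_scale[of "\<lambda>x. ennreal (u x)"] l)
  also have "\<dots> = ennreal (b * (l powr - d * M))" unfolding M(1) using b M l by (simp add: ennreal_mult)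
  also have "b * (l powr - d * M) = 1" using l M by (simp add: b_def powr_minus)
  finally have mv: "mass v = 1" by simp
  have bm: "b powr m * l powr - d = M powr - m * l powr (d * (m - 1))"
  proof -
    have "b powr m = M powr - m * l powr (d * m)"
      using l M by (simp add: b_def powr_divide powr_powr powr_minus_divide)
    moreover have "l powr (d * m) * l powr - d = l powr (d * (m - 1))"
      unfolding powr_add[symmetric] by (simp add: algebra_simps)
    ultimately show ?thesis by (simp add: mult.assoc)
  qed
  have "power_mass m v = (\<integral>\<^sup>+x. ennreal (b powr m) * ennreal (u (l *\<^sub>R x) powr m) \<partial>lborel)"
    unfolding power_mass_def v using b subdensityD(2)[OF u] by (simp add: ennreal_mult powr_mult)
  also have "\<dots> = ennreal (b powr m) * (ennreal (l powr - d) * power_mass m u)"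
    unfolding power_mass_def d_def by (subst nn_integral_cmult) (auto simp: nn_integral_lborel_scale[of "\<lambda>x. ennreal (u x powr m)"] l)
  also have "\<dots> = ennreal (b powr m * l powr - d * Pr u)"
    unfolding power_mass_eq_Pr[OF u] using Pr_nonneg[of u] by (simp add: ennreal_mult mult.assoc)
  finally have pv: "power_mass m v = ennreal (M powr - m * l powr (d * (m - 1)) * Pr u)" unfolding bm .
  have "subdensity v" unfolding subdensity_def using v_meas v_nonneg mv pv by simp
  then show "v \<in> densities" using mv by (simp add: densities_def)
  show "Pr v = M powr - m * l powr (real DIM('a) * (m - 1)) * Pr u"
    unfolding Pr_def[of v] pv d_def using Pr_nonneg[of u] by simp
  have bW: "b\<^sup>2 * l powr (\<alpha> - 2 * d) = M powr - 2 * l powr \<alpha>"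
  proof -
    have "(l powr d)\<^sup>2 * l powr (\<alpha> - 2 * d) = l powr \<alpha>"
      using l by (simp add: power2_eq_square powr_add[symmetric])
    then show ?thesis using M by (simp add: b_def power_divide powr_minus_divide)
  qed
  have "W v = ennreal (M powr - 2 * l powr \<alpha>) * W u"
    unfolding v by (subst interaction_riesz_scale) (use subdensityD[OF u] b l bW in \<open>auto simp: d_def\<close>)
  then show "Wr v = M powr - 2 * l powr \<alpha> * Wr u"
    unfolding Wr_def by (simp add: enn2real_mult)
qed

text \<open>With D = d (m - 1) - \<alpha> and \<open>l = M powr ((m - 2) / D)\<close>, both
  prefactors in \<open>rescale_to_density\<close> equal \<open>M powr - \<gamma>\<close>; this
  requirement determines \<open>l\<close> and \<gamma>.\<close>

definition \<gamma> :: real where "\<gamma> = 2 - \<alpha> * (m - 2) / (real DIM('a) * (m - 1) - \<alpha>)"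

text \<open>Clearing the denominator turns the claim into \<alpha> (m - 1) < d (m - 1), that is,
  \<alpha> < d.\<close>

lemma gamma_gt_1: "\<gamma> > 1"
proof -
  have "real DIM('a) * (m - 1) - \<alpha> > 0" using alpha_m by (simp add: mult.commute)
  moreover have "\<alpha> * (m - 2) < real DIM('a) * (m - 1) - \<alpha>"
    using mult_strict_right_mono[OF alpha_dim, of "m - 1"] m_gt_1 by (simp add: algebra_simps)
  ultimately show ?thesis by (simp add: \<gamma>_def)
qed

text \<open>The dilation factor \<open>l\<close> is chosen so that both terms scale like \<open>M\<^sup>\<gamma>\<close>.\<close>

lemma le_J_subdensity:
  assumes u: "subdensity u" and M: "mass u = ennreal M" "M \<ge> 0"
  shows "Wr u \<le> \<kappa> * Pr u + J * M powr \<gamma>"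
proof (cases "M = 0")
  case True
  then have "W u = 0" using M subdensityD[OF u] by (intro interaction_zero_mass) auto
  then show ?thesis using True kappa_pos Pr_nonneg by (simp add: Wr_def)
next
  case False
  then have M0: "M > 0" using M by simp
  define D where "D = real DIM('a) * (m - 1) - \<alpha>"
  have D: "D > 0" using alpha_m by (simp add: D_def mult.commute)
  define l where "l = M powr ((m - 2) / D)"
  have l: "l > 0" using M0 by (simp add: l_def)
  define v where "v = (\<lambda>x. l powr real DIM('a) / M * u (l *\<^sub>R x))"
  note v = rescale_to_density[OF u M(1) M0 l, folded v_def]
  have e: "- 2 + (m - 2) / D * \<alpha> = - \<gamma>" by (simp add: \<gamma>_def D_def)
  have W: "M powr - 2 * l powr \<alpha> = M powr - \<gamma>"
    unfolding l_def powr_powr powr_add[symmetric] e by (rule refl)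
  have "\<gamma> = 2 - \<alpha> * (m - 2) / D" by (simp add: \<gamma>_def D_def)
  then have "- m + (m - 2) / D * (D + \<alpha>) = - \<gamma>"
    using D by (simp add: field_simps)
  then have P: "M powr - m * l powr (real DIM('a) * (m - 1)) = M powr - \<gamma>"
    unfolding l_def powr_powr powr_add[symmetric] by (simp add: D_def)
  have "M powr - \<gamma> * Wr u \<le> \<kappa> * (M powr - \<gamma> * Pr u) + J"
    using le_J[OF v(1)] unfolding v(2,3) W P .
  then have "M powr \<gamma> * (M powr - \<gamma> * Wr u) \<le> M powr \<gamma> * (\<kappa> * (M powr - \<gamma> * Pr u) + J)"
    by (rule mult_left_mono) simp
  moreover have "M powr \<gamma> * M powr - \<gamma> = 1" using M0 by (simp add: powr_add[symmetric])
  then have "M powr \<gamma> * (M powr - \<gamma> * x) = x" for x by (simp add: mult.assoc[symmetric])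
  then have "M powr \<gamma> * (M powr - \<gamma> * Wr u) = Wr u"
    "M powr \<gamma> * (\<kappa> * (M powr - \<gamma> * Pr u) + J) = \<kappa> * Pr u + J * M powr \<gamma>"
    by (simp_all add: distrib_left mult.left_commute mult.commute)
  ultimately show ?thesis by simp
qed

lemma densities_ball:
  obtains u where "u \<in> densities" "Wr u > 0"
proof -
  define V where "V = unit_ball_vol (real DIM('a))"
  have V: "V > 0" by (simp add: V_def)
  define u :: "'a \<Rightarrow> real" where "u x = indicator (ball 0 1) x / V" for x
  have [measurable]: "ball (0::'a) 1 \<in> sets borel" by simp
  have [measurable]: "u \<in> borel_measurable borel" unfolding u_def by measurable
  have vol: "emeasure lborel (ball (0::'a) 1) = ennreal V" by (simp add: emeasure_ball V_def)
  have "mass u = (\<integral>\<^sup>+x. ennreal (1 / V) * indicator (ball (0::'a) 1) x \<partial>lborel)"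
    unfolding mass_def u_def by (intro nn_integral_cong) (auto simp: indicator_def)
  also have "\<dots> = 1" using V by (simp add: nn_integral_cmult_indicator vol ennreal_mult[symmetric])
  finally have mu: "mass u = 1" .
  have "power_mass m u = (\<integral>\<^sup>+x. ennreal ((1 / V) powr m) * indicator (ball (0::'a) 1) x \<partial>lborel)"
    unfolding power_mass_def u_def by (intro nn_integral_cong) (auto simp: indicator_def)
  also have "\<dots> < \<infinity>" by (simp add: nn_integral_cmult_indicator vol ennreal_mult_less_top)
  finally have su: "subdensity u" using mu V by (simp add: subdensity_def u_def)
  have "ennreal (2 powr - \<alpha>) * (mass u * mass u) \<le> W u"
    by (rule interaction_riesz_lower) (auto simp: u_def alpha_pos)
  then have "ennreal (2 powr - \<alpha>) \<le> ennreal (Wr u)" by (simp add: mu W_eq_Wr[OF su])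
  then have "2 powr - \<alpha> \<le> Wr u" using Wr_nonneg by (simp add: ennreal_le_iff)
  moreover have "(2::real) powr - \<alpha> > 0" by simp
  ultimately have "Wr u > 0" by linarith
  then show ?thesis using that[of u] su mu by (simp add: densities_def)
qed

text \<open>Under a dilation W scales like the power \<alpha> of \<open>l\<close> and P like the
  larger power \<alpha> + D. Spreading the density out, that is, a small \<open>l\<close>, therefore
  lets attraction win.\<close>

lemma J_pos: "J > 0"
proof -
  obtain u where u: "u \<in> densities" "Wr u > 0" by (rule densities_ball)
  then have su: "subdensity u" and mu: "mass u = ennreal 1" by (auto simp: densities_def)
  define D where "D = real DIM('a) * (m - 1) - \<alpha>"
  have D: "D > 0" using alpha_m by (simp add: D_def mult.commute)
  \<comment> \<open>\<open>q\<close>, the value of \<open>l powr D\<close>, solves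
    \<open>Wr u - \<kappa> * Pr u * q = q\<close>, so the dilated density has value exactly
    \<open>l powr \<alpha> * q\<close>.\<close>
  define q where "q = Wr u / (\<kappa> * Pr u + 1)"
  have k: "0 \<le> \<kappa> * Pr u" using kappa_pos Pr_nonneg[of u] by simp
  have q: "q > 0" using u k by (simp add: q_def add_nonneg_pos)
  define l where "l = q powr (1 / D)"
  have l: "l > 0" using q by (simp add: l_def)
  have lD: "l powr D = q" using q D by (simp add: l_def powr_powr)
  define v where "v = (\<lambda>x. l powr real DIM('a) / 1 * u (l *\<^sub>R x))"
  note v = rescale_to_density[OF su mu zero_less_one l, folded v_def]
  have "l powr (real DIM('a) * (m - 1)) = l powr \<alpha> * q"
    unfolding lD[symmetric] by (simp add: D_def powr_add[symmetric])
  then have "l powr \<alpha> * Wr u \<le> \<kappa> * (l powr \<alpha> * q * Pr u) + J"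
    using le_J[OF v(1)] unfolding v(2,3) by simp
  then have "l powr \<alpha> * (Wr u - \<kappa> * Pr u * q) \<le> J" by (simp add: algebra_simps)
  moreover have "Wr u - \<kappa> * Pr u * q = q"
    using k by (simp add: q_def field_simps add_nonneg_eq_0_iff)
  ultimately show ?thesis using q l by (metis mult_pos_pos order_less_le_trans powr_gt_zero less_irrefl)
qed

end

section \<open>Tightness\<close>

lemma interaction_commute:
  assumes [measurable]: "k \<in> borel_measurable borel" "u \<in> borel_measurable borel" "v \<in> borel_measurable borel"
    and k: "\<And>z. k (- z) = k z"
  shows "interaction k u v = interaction k v u"
proof -
  have eq: "k (x - y) = k (y - x)" for x y using k[of "x - y"] by simp
  have "interaction k u v = (\<integral>\<^sup>+y. \<integral>\<^sup>+x. k (x - y) * (ennreal (u x) * ennreal (v y)) \<partial>lborel \<partial>lborel)"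
    unfolding interaction_def
    by (rule lborel_pair.Fubini'[of "\<lambda>x y. k (x - y) * (ennreal (u x) * ennreal (v y))", symmetric]) measurable
  also have "\<dots> = interaction k v u"
    unfolding interaction_def by (intro nn_integral_cong) (simp add: eq mult_ac)
  finally show ?thesis .
qed

lemma interaction_cut:
  fixes u :: "'a::euclidean_space \<Rightarrow> real"
  assumes [measurable]: "k \<in> borel_measurable borel" "u \<in> borel_measurable borel" "A \<in> sets borel"
    and k: "\<And>z. k (- z) = k z"
  defines "u1 \<equiv> \<lambda>x. u x * indicator A x" and "u2 \<equiv> \<lambda>x. u x * indicator (- A) x"
  shows "interaction k u u = interaction k u1 u1 + interaction k u2 u2 + 2 * interaction k u1 u2"
proof -
  have [measurable]: "u1 \<in> borel_measurable borel" "u2 \<in> borel_measurable borel"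
    unfolding u1_def u2_def by measurable
  let ?i = "\<lambda>v w x y. k (x - y) * (ennreal (v x) * ennreal (w y))"
  have "interaction k u u = (\<integral>\<^sup>+x. \<integral>\<^sup>+y. (?i u1 u1 x y + ?i u2 u2 x y) + (?i u1 u2 x y + ?i u2 u1 x y) \<partial>lborel \<partial>lborel)"
    unfolding interaction_def by (intro nn_integral_cong) (auto simp: u1_def u2_def indicator_def)
  also have "\<dots> = (interaction k u1 u1 + interaction k u2 u2) + (interaction k u1 u2 + interaction k u2 u1)"
    unfolding interaction_def by (simp add: nn_integral_add)
  also have "interaction k u2 u1 = interaction k u1 u2"
    by (rule interaction_commute) (auto simp: k)
  finally show ?thesis by (simp add: mult_2)
qed

section \<open>Excluding dichotomy for near-maximisers\<close>

context aggregation_diffusion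
begin

lemma subdensity_restrict:
  assumes u: "subdensity u" and [measurable]: "A \<in> sets borel"
  shows "subdensity (\<lambda>x. u x * indicator A x)"
proof -
  note [measurable] = subdensityD(1)[OF u]
  have "mass (\<lambda>x. u x * indicator A x) \<le> mass u"
    unfolding mass_def using subdensityD(2)[OF u] by (intro nn_integral_mono ennreal_leI) (auto simp: indicator_def)
  moreover have "power_mass m (\<lambda>x. u x * indicator A x) \<le> power_mass m u"
    unfolding power_mass_def using subdensityD(2)[OF u] by (intro nn_integral_mono ennreal_leI) (auto simp: indicator_def)
  ultimately show ?thesis
    using subdensityD[OF u] unfolding subdensity_def by (auto intro: order_trans order_le_less_trans)
qed

lemma Pr_cut:
  assumes u: "subdensity u" and [measurable]: "A \<in> sets borel"
  shows "Pr u = Pr (\<lambda>x. u x * indicator A x) + Pr (\<lambda>x. u x * indicator (- A) x)"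
proof -
  note [measurable] = subdensityD(1)[OF u]
  have "power_mass m u = (\<integral>\<^sup>+x. ennreal ((u x * indicator A x) powr m) + ennreal ((u x * indicator (- A) x) powr m) \<partial>lborel)"
    unfolding power_mass_def by (intro nn_integral_cong) (auto simp: indicator_def)
  also have "\<dots> = power_mass m (\<lambda>x. u x * indicator A x) + power_mass m (\<lambda>x. u x * indicator (- A) x)"
    unfolding power_mass_def by (intro nn_integral_add) measurable
  finally show ?thesis
    using subdensity_restrict[OF u, of A] subdensity_restrict[OF u, of "- A"] Pr_nonneg
    by (simp add: power_mass_eq_Pr u ennreal_plus[symmetric] del: ennreal_plus)
qed

lemma mass_cut:
  assumes [measurable]: "u \<in> borel_measurable borel" "A \<in> sets borel"
  shows "mass u = mass (\<lambda>x. u x * indicator A x) + mass (\<lambda>x. u x * indicator (- A) x)"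
proof -
  have "mass u = (\<integral>\<^sup>+x. ennreal (u x * indicator A x) + ennreal (u x * indicator (- A) x) \<partial>lborel)"
    unfolding mass_def by (intro nn_integral_cong) (auto simp: indicator_def)
  also have "\<dots> = mass (\<lambda>x. u x * indicator A x) + mass (\<lambda>x. u x * indicator (- A) x)"
    unfolding mass_def by (intro nn_integral_add) measurable
  finally show ?thesis .
qed

text \<open>Strict subadditivity of \<open>M \<mapsto> M\<^sup>\<gamma>\<close>: a near-maximiser cannot be cut into two pieces with little
  interaction unless one of them has little mass.\<close>

lemma cut_mass_bound:
  assumes u: "u \<in> densities" and near_max: "Wr u - \<kappa> * Pr u \<ge> J - \<tau>"
    and A[measurable]: "A \<in> sets borel" and c: "0 < c" "c \<le> 1"
    and mA: "mass (\<lambda>x. u x * indicator A x) \<ge> ennreal c"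
    and I: "interaction (riesz \<alpha>) (\<lambda>x. u x * indicator A x) (\<lambda>x. u x * indicator (- A) x) \<le> ennreal \<iota>" "\<iota> \<ge> 0"
  obtains M where "M \<ge> 0" "mass (\<lambda>x. u x * indicator (- A) x) = ennreal M"
    "J * (M * (1 - (1 - c) powr (\<gamma> - 1))) \<le> \<tau> + 2 * \<iota>"
proof -
  have su: "subdensity u" and mu: "mass u = 1" using u by (auto simp: densities_def)
  note [measurable] = subdensityD(1)[OF su]
  define u1 u2 where "u1 = (\<lambda>x. u x * indicator A x)" and "u2 = (\<lambda>x. u x * indicator (- A) x)"
  have s1: "subdensity u1" and s2: "subdensity u2"
    unfolding u1_def u2_def by (auto intro!: subdensity_restrict su)
  define M1 M2 where "M1 = enn2real (mass u1)" and "M2 = enn2real (mass u2)"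
  have M1: "mass u1 = ennreal M1" "0 \<le> M1"
    using subdensityD(3)[OF s1] unfolding M1_def
    by (metis ennreal_enn2real ennreal_one_less_top order_le_less_trans, simp)
  have M2: "mass u2 = ennreal M2" "0 \<le> M2"
    using subdensityD(3)[OF s2] unfolding M2_def
    by (metis ennreal_enn2real ennreal_one_less_top order_le_less_trans, simp)
  have "ennreal 1 = ennreal (M1 + M2)"
    using mass_cut[of u A] M1 M2 by (simp add: mu u1_def u2_def)
  then have sum1: "M1 + M2 = 1" using M1(2) M2(2) by (subst (asm) ennreal_inj) auto
  have M1c: "M1 \<ge> c" using mA M1 c by (simp add: u1_def[symmetric])
  have "ennreal (Wr u) = ennreal (Wr u1) + ennreal (Wr u2) + 2 * interaction (riesz \<alpha>) u1 u2"
    using interaction_cut[of "riesz \<alpha>" u A] s1 s2 su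
    by (simp add: u1_def[symmetric] u2_def[symmetric] W_eq_Wr)
  also have "\<dots> \<le> ennreal (Wr u1) + ennreal (Wr u2) + 2 * ennreal \<iota>"
    using I(1) by (intro add_left_mono mult_left_mono) (auto simp: u1_def u2_def)
  also have "\<dots> = ennreal (Wr u1 + Wr u2 + 2 * \<iota>)"
    using I(2) Wr_nonneg by (simp add: ennreal_mult)
  finally have W: "Wr u \<le> Wr u1 + Wr u2 + 2 * \<iota>"
    using I(2) Wr_nonneg[of u1] Wr_nonneg[of u2] by (subst (asm) ennreal_le_iff) auto
  have P: "Pr u = Pr u1 + Pr u2" unfolding u1_def u2_def by (rule Pr_cut[OF su A])
  have "Wr u1 \<le> \<kappa> * Pr u1 + J * M1 powr \<gamma>" "Wr u2 \<le> \<kappa> * Pr u2 + J * M2 powr \<gamma>"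
    using le_J_subdensity[OF s1 M1] le_J_subdensity[OF s2 M2] by auto
  then have 1: "J - \<tau> \<le> J * M1 powr \<gamma> + J * M2 powr \<gamma> + 2 * \<iota>"
    using W near_max unfolding P by (simp add: distrib_left)
  \<comment> \<open>The first piece is estimated without gain; the gain comes from
    \<open>M2 \<le> 1 - c\<close> in \<open>g2\<close>. Together they bound
    \<open>1 - M1 powr \<gamma> - M2 powr \<gamma>\<close> below by a fixed positive fraction of
    \<open>M2\<close>.\<close>
  have "M1 powr \<gamma> \<le> M1 powr 1"
    using M1 M2 sum1 M1c c gamma_gt_1 by (intro powr_mono') auto
  then have g1: "M1 powr \<gamma> \<le> M1" using M1 by simp
  have g2: "M2 powr \<gamma> \<le> M2 * (1 - c) powr (\<gamma> - 1)"
  proof (cases "M2 = 0")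
    case False
    then have "M2 > 0" using M2 by simp
    then have "M2 powr \<gamma> = M2 * M2 powr (\<gamma> - 1)" by (simp add: powr_diff)
    also have "\<dots> \<le> M2 * (1 - c) powr (\<gamma> - 1)"
      using M2 sum1 M1c gamma_gt_1 by (intro mult_left_mono powr_mono2) auto
    finally show ?thesis .
  qed simp
  have "J * (M2 * (1 - (1 - c) powr (\<gamma> - 1))) \<le> J * (1 - M1 powr \<gamma> - M2 powr \<gamma>)"
    using g1 g2 sum1 J_pos by (intro mult_left_mono) (auto simp: algebra_simps)
  also have "\<dots> \<le> \<tau> + 2 * \<iota>" using 1 by (simp add: algebra_simps)
  finally show ?thesis using that[of M2] M2 by (simp add: u2_def)
qed

text \<open>A pair separated by the sphere is closer than \<open>r\<close>, or its outer point lies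
  in the annulus of width \<open>D\<close> with kernel at most \<open>r powr - \<alpha>\<close>, or
  its points are at least \<open>D\<close> apart. The three terms correspond to these cases.\<close>

lemma cross_interaction_bound:
  assumes u: "u \<in> densities" and r: "r > 0" and D: "D > 0"
  shows "interaction (riesz \<alpha>) (\<lambda>x. u x * indicator (ball x0 s) x) (\<lambda>x. u x * indicator (- ball x0 s) x)
    \<le> near r u + ennreal (r powr - \<alpha>) * mass (\<lambda>x. u x * indicator (ball x0 (s + D) - ball x0 s) x) + ennreal (D powr - \<alpha>)"
proof -
  have su: "subdensity u" and mu: "mass u = 1" using u by (auto simp: densities_def)
  note [measurable] = subdensityD(1)[OF su]
  have [measurable]: "ball z t \<in> sets borel" for z :: 'a and t by simp
  define w where "w = (\<lambda>x. u x * indicator (ball x0 (s + D) - ball x0 s) x)"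
  have [measurable]: "w \<in> borel_measurable borel" unfolding w_def by measurable
  let ?n = "\<lambda>z::'a. riesz \<alpha> z * indicator (ball 0 r) z"
  have [measurable]: "?n \<in> borel_measurable borel" by measurable
  have pt: "riesz \<alpha> (x - y) * (ennreal (u x * indicator (ball x0 s) x) * ennreal (u y * indicator (- ball x0 s) y))
      \<le> ?n (x - y) * (ennreal (u x) * ennreal (u y)) + ennreal (r powr - \<alpha>) * (ennreal (u x) * ennreal (w y))
        + ennreal (D powr - \<alpha>) * (ennreal (u x) * ennreal (u y))" for x y
  proof (cases "x \<in> ball x0 s \<and> y \<notin> ball x0 s")
    case True
    show ?thesis
    proof (cases "norm (x - y) < r")
      case True
      then show ?thesis using \<open>x \<in> ball x0 s \<and> y \<notin> ball x0 s\<close> by (simp add: add_increasing2 add.assoc)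
    next
      case far: False
      show ?thesis
      proof (cases "y \<in> ball x0 (s + D)")
        case y: True
        have "riesz \<alpha> (x - y) \<le> ennreal (r powr - \<alpha>)"
          using riesz_far_le[OF r alpha_pos, of "x - y"] far by simp
        then show ?thesis using True y far
          by (simp add: w_def add_increasing2 mult_right_mono)
      next
        case y: False
        have "dist x0 y \<le> dist x0 x + dist x y" by (rule dist_triangle)
        then have "\<not> norm (x - y) < D" using True y by (auto simp: dist_norm)
        then have "riesz \<alpha> (x - y) \<le> ennreal (D powr - \<alpha>)"
          using riesz_far_le[OF D alpha_pos, of "x - y"] by simp
        then show ?thesis using True y far
          by (simp add: w_def add_increasing mult_right_mono)
      qed
    qed
  qed auto
  have "interaction (riesz \<alpha>) (\<lambda>x. u x * indicator (ball x0 s) x) (\<lambda>x. u x * indicator (- ball x0 s) x)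
    \<le> (\<integral>\<^sup>+x. \<integral>\<^sup>+y. ?n (x - y) * (ennreal (u x) * ennreal (u y)) + ennreal (r powr - \<alpha>) * (ennreal (u x) * ennreal (w y))
        + ennreal (D powr - \<alpha>) * (ennreal (u x) * ennreal (u y)) \<partial>lborel \<partial>lborel)"
    unfolding interaction_def by (intro nn_integral_mono pt)
  also have "\<dots> = near r u + interaction (\<lambda>_. ennreal (r powr - \<alpha>)) u w + interaction (\<lambda>_. ennreal (D powr - \<alpha>)) u u"
    unfolding interaction_def by (simp add: nn_integral_add)
  also have "\<dots> = near r u + ennreal (r powr - \<alpha>) * mass w + ennreal (D powr - \<alpha>)"
    by (simp add: interaction_const mu)
  finally show ?thesis unfolding w_def .
qed

text \<open>Pigeonhole: \<open>N\<close> consecutive annuli share a total mass of at most 1.\<close>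

lemma annulus_small_mass:
  assumes u: "u \<in> densities" and D: "D > 0" and N: "N > (0::nat)"
  obtains k where "k < N"
    "mass (\<lambda>x. u x * indicator (ball x0 (R + real k * D + D) - ball x0 (R + real k * D)) x) \<le> ennreal (1 / real N)"
proof (rule ccontr)
  assume no: "\<not> thesis"
  note found = that
  define w where "w k x = u x * indicator (ball x0 (R + real k * D + D) - ball x0 (R + real k * D)) x" for k x
  have su: "subdensity u" and mu: "mass u = 1" using u by (auto simp: densities_def)
  note [measurable] = subdensityD(1)[OF su]
  have [measurable]: "ball z t \<in> sets borel" for z :: 'a and t by simp
  have [measurable]: "w k \<in> borel_measurable borel" for k unfolding w_def by measurable
  have w_nonneg: "0 \<le> w k x" for k x using subdensityD(2)[OF su] by (simp add: w_def)
  have large: "\<not> mass (w k) \<le> ennreal (1 / real N)" if "k < N" for k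
    using no found[OF that] unfolding w_def by blast
  have le: "(\<Sum>k<N. w k x) \<le> u x" for x
  proof -
    \<comment> \<open>The indicator of an annulus is the difference of two consecutive ball
      indicators, so the sum over \<open>k\<close> telescopes.\<close>
    define b where "b k = (indicator (ball x0 (R + real k * D)) x :: real)" for k
    have "w k x = u x * (b (Suc k) - b k)" for k
      using D by (auto simp: w_def b_def indicator_def algebra_simps)
    then have "(\<Sum>k<N. w k x) = u x * (b N - b 0)"
      by (simp add: sum_distrib_left[symmetric] sum_lessThan_telescope)
    also have "\<dots> \<le> u x * 1"
      by (intro mult_left_mono subdensityD(2)[OF su]) (auto simp: b_def indicator_def)
    finally show ?thesis by simp
  qed
  have "(\<Sum>k<N. mass (w k)) = (\<integral>\<^sup>+x. (\<Sum>k<N. ennreal (w k x)) \<partial>lborel)"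
    unfolding mass_def by (subst nn_integral_sum) auto
  also have "\<dots> \<le> mass u"
    unfolding mass_def using le w_nonneg by (intro nn_integral_mono) (simp add: sum_ennreal ennreal_leI)
  finally have upper: "(\<Sum>k<N. mass (w k)) \<le> 1" by (simp add: mu)
  have fin: "mass (w k) = ennreal (enn2real (mass (w k)))" if "k < N" for k
  proof -
    have "mass (w k) \<le> (\<Sum>k<N. mass (w k))" using that by (intro member_le_sum) auto
    then have "mass (w k) < top" using upper ennreal_one_less_top by (metis order_trans order_le_less_trans)
    then show ?thesis by simp
  qed
  have "1 / real N < enn2real (mass (w k))" if "k < N" for k
    using large[OF that] by (subst (asm) fin[OF that]) (simp add: not_le ennreal_less_iff)
  then have "(\<Sum>k<N. 1 / real N) < (\<Sum>k<N. enn2real (mass (w k)))"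
    using N by (intro sum_strict_mono) auto
  then have gt: "1 < (\<Sum>k<N. enn2real (mass (w k)))" using N by simp
  have "(\<Sum>k<N. mass (w k)) = ennreal (\<Sum>k<N. enn2real (mass (w k)))"
    using fin by (subst sum_ennreal[symmetric]) auto
  then show False using upper gt by simp
qed

text \<open>Coercivity with \<theta> = \<kappa>/2 absorbs the attraction into half of the diffusion
  term.\<close>

lemma near_maximal_Pr_bound:
  obtains c where "c \<ge> 0" "\<And>u. subdensity u \<Longrightarrow> 0 \<le> Wr u - \<kappa> * Pr u \<Longrightarrow> Pr u \<le> c"
proof -
  obtain K where K: "K \<ge> 0" "\<And>u. subdensity u \<Longrightarrow> Wr u \<le> \<kappa> / 2 * Pr u + K"
    using coercive_real[of "\<kappa> / 2"] kappa_pos by auto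
  have "Pr u \<le> 2 * K / \<kappa>" if "subdensity u" "0 \<le> Wr u - \<kappa> * Pr u" for u
    using K(2)[OF that(1)] that(2) kappa_pos by (simp add: field_simps)
  then show ?thesis using that[of "2 * K / \<kappa>"] K(1) kappa_pos by simp
qed

text \<open>The annulus along which to cut depends on the density and the centre, but it is found
  among \<open>N\<close> annuli of width \<open>D\<close> around the ball of radius
  \<open>R\<close>. All of them lie within radius \<open>R + real N * D\<close>, which gives a
  uniform \<open>R'\<close>.\<close>

lemma near_maximal_tight:
  assumes c: "0 < c" "c \<le> 1" and R: "R > 0" and \<delta>: "\<delta> > 0"
  obtains \<tau> R' where "\<tau> > 0" "R' > 0" "\<And>u x. u \<in> densities \<Longrightarrow> Wr u - \<kappa> * Pr u \<ge> J - \<tau> \<Longrightarrow>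
    mass (\<lambda>y. u y * indicator (ball x R) y) \<ge> ennreal c \<Longrightarrow>
    mass (\<lambda>y. u y * indicator (- ball x R') y) \<le> ennreal \<delta>"
proof -
  obtain c0 where c0: "c0 \<ge> 0" "\<And>u. subdensity u \<Longrightarrow> 0 \<le> Wr u - \<kappa> * Pr u \<Longrightarrow> Pr u \<le> c0"
    using near_maximal_Pr_bound by blast
  define s where "s = 1 - (1 - c) powr (\<gamma> - 1)"
  have "(1 - c) powr (\<gamma> - 1) < 1 powr (\<gamma> - 1)"
    using c gamma_gt_1 by (intro powr_less_mono2) auto
  then have s: "s > 0" by (simp add: s_def)
  \<comment> \<open>Below, \<open>r\<close>, \<open>N\<close> and \<open>D\<close> make each of the
    three terms of the cross interaction at most \<omega>. The loss permitted by
    \<open>cut_mass_bound\<close> is then at most \<tau> + 2 (3 \<omega>), hence at most 8 \<omega>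
    = \<delta> J s, and this forces the outer mass below \<delta>.\<close>
  define \<omega> where "\<omega> = \<delta> * (J * s) / 8"
  have om: "\<omega> > 0" using \<delta> s J_pos by (simp add: \<omega>_def)
  obtain r where r: "r > 0" "\<And>u. subdensity u \<Longrightarrow> power_mass m u \<le> ennreal c0 \<Longrightarrow> near r u \<le> ennreal \<omega>"
    using near_uniformly_small[OF c0(1) om] by blast
  define N where "N = nat \<lceil>r powr - \<alpha> / \<omega>\<rceil> + 1"
  have N: "N > 0" "r powr - \<alpha> / real N \<le> \<omega>"
  proof -
    show "N > 0" by (simp add: N_def)
    have "r powr - \<alpha> / \<omega> \<le> real N" unfolding N_def by linarith
    then have "r powr - \<alpha> \<le> real N * \<omega>" using om by (simp only: pos_divide_le_eq)
    then show "r powr - \<alpha> / real N \<le> \<omega>" using \<open>N > 0\<close> by (simp only: pos_divide_le_eq of_nat_0_less_iff mult.commute)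
  qed
  define D where "D = \<omega> powr (- 1 / \<alpha>)"
  have D: "D > 0" "D powr - \<alpha> = \<omega>" using om alpha_pos by (auto simp: D_def powr_powr)
  \<comment> \<open>\<open>\<tau> \<le> J\<close> keeps the functional nonnegative, as the bound on
    \<open>Pr u\<close> requires; \<open>\<tau> \<le> \<omega>\<close> enters the final
    count.\<close>
  define \<tau> where "\<tau> = min J \<omega>"
  have tau: "\<tau> > 0" "\<tau> \<le> J" "\<tau> \<le> \<omega>" using J_pos om by (auto simp: \<tau>_def)
  have "mass (\<lambda>y. u y * indicator (- ball x (R + real N * D)) y) \<le> ennreal \<delta>"
    if u: "u \<in> densities" and nm: "Wr u - \<kappa> * Pr u \<ge> J - \<tau>"
      and mc: "mass (\<lambda>y. u y * indicator (ball x R) y) \<ge> ennreal c" for u x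
  proof -
    have su: "subdensity u" using u by (auto simp: densities_def)
    have [measurable]: "ball z t \<in> sets borel" for z :: 'a and t by simp
    have "Pr u \<le> c0" using c0(2)[OF su] nm tau by simp
    then have nr: "near r u \<le> ennreal \<omega>" by (intro r su) (simp add: power_mass_eq_Pr[OF su] ennreal_leI)
    obtain k where k: "k < N" "mass (\<lambda>y. u y * indicator (ball x (R + real k * D + D) - ball x (R + real k * D)) y) \<le> ennreal (1 / real N)"
      using annulus_small_mass[OF u D(1) N(1)] by blast
    let ?B = "ball x (R + real k * D)"
    have "interaction (riesz \<alpha>) (\<lambda>y. u y * indicator ?B y) (\<lambda>y. u y * indicator (- ?B) y)
      \<le> near r u + ennreal (r powr - \<alpha>) * mass (\<lambda>y. u y * indicator (ball x (R + real k * D + D) - ?B) y) + ennreal (D powr - \<alpha>)"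
      by (rule cross_interaction_bound[OF u r(1) D(1)])
    also have "\<dots> \<le> ennreal \<omega> + ennreal (r powr - \<alpha>) * ennreal (1 / real N) + ennreal \<omega>"
      unfolding D(2) by (intro add_mono mult_left_mono nr k(2)) auto
    also have "\<dots> = ennreal (\<omega> + r powr - \<alpha> / real N + \<omega>)"
      using om by (simp add: ennreal_mult[symmetric] ennreal_plus[symmetric] del: ennreal_plus)
    also have "\<dots> \<le> ennreal (3 * \<omega>)" using N(2) by (intro ennreal_leI) linarith
    finally have I: "interaction (riesz \<alpha>) (\<lambda>y. u y * indicator ?B y) (\<lambda>y. u y * indicator (- ?B) y) \<le> ennreal (3 * \<omega>)" .
    have "R \<le> R + real k * D" using D(1) by simp
    then have "ball x R \<subseteq> ?B" by (rule subset_ball)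
    then have "mass (\<lambda>y. u y * indicator (ball x R) y) \<le> mass (\<lambda>y. u y * indicator ?B y)"
      unfolding mass_def using subdensityD(2)[OF su]
      by (intro nn_integral_mono ennreal_leI mult_left_mono) (auto simp: indicator_def)
    then have mB: "mass (\<lambda>y. u y * indicator ?B y) \<ge> ennreal c" using mc by (rule order_trans[rotated])
    obtain M where M: "M \<ge> 0" "mass (\<lambda>y. u y * indicator (- ?B) y) = ennreal M" "J * (M * s) \<le> \<tau> + 2 * (3 * \<omega>)"
    proof -
      have "?B \<in> sets borel" "0 \<le> 3 * \<omega>" using om by auto
      from cut_mass_bound[OF u nm this(1) c mB I this(2)] show ?thesis
        using that unfolding s_def by blast
    qed
    have "8 * \<omega> = \<delta> * (J * s)" by (simp add: \<omega>_def)
    moreover have "\<tau> + 2 * (3 * \<omega>) \<le> 8 * \<omega>" using tau(3) om by linarith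
    moreover have "J * (M * s) = M * (J * s)" by (simp only: mult.left_commute)
    ultimately have "M * (J * s) \<le> \<delta> * (J * s)" using M(3) by linarith
    then have "M \<le> \<delta>" using J_pos s by simp
    have "R + real k * D \<le> R + real N * D" using k(1) D(1) by (simp add: mult_right_mono)
    then have "mass (\<lambda>y. u y * indicator (- ball x (R + real N * D)) y) \<le> mass (\<lambda>y. u y * indicator (- ?B) y)"
      unfolding mass_def using subdensityD(2)[OF su]
      by (intro nn_integral_mono ennreal_leI mult_left_mono) (auto simp: indicator_def)
    also have "\<dots> \<le> ennreal \<delta>" unfolding M(2) using \<open>M \<le> \<delta>\<close> by (rule ennreal_leI)
    finally show ?thesis .
  qed
  then show ?thesis using that[OF tau(1), of "R + real N * D"] R D(1) by (simp add: add_pos_nonneg)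
qed

end

section \<open>Existence of a maximiser\<close>

definition law :: "('a::euclidean_space \<Rightarrow> real) \<Rightarrow> 'a measure" where
  "law u = density lborel (\<lambda>x. ennreal (u x))"

lemma sets_law[simp, measurable_cong]: "sets (law u) = sets borel"
  and space_law[simp]: "space (law u) = UNIV"
  by (simp_all add: law_def)

lemma nn_integral_law:
  assumes [measurable]: "u \<in> borel_measurable borel" "f \<in> borel_measurable borel"
  shows "(\<integral>\<^sup>+x. f x \<partial>law u) = (\<integral>\<^sup>+x. ennreal (u x) * f x \<partial>lborel)"
  unfolding law_def by (subst nn_integral_density) auto

lemma prob_space_law:
  assumes [measurable]: "u \<in> borel_measurable borel" and "mass u = 1"
  shows "prob_space (law u)"
proof
  have "emeasure (law u) (space (law u)) = (\<integral>\<^sup>+x. 1 \<partial>law u)" by simp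
  also have "\<dots> = 1" using assms(2) by (subst nn_integral_law) (auto simp: mass_def)
  finally show "emeasure (law u) (space (law u)) = 1" .
qed

lemma interaction_law:
  assumes [measurable]: "u \<in> borel_measurable borel" "k \<in> borel_measurable borel" and "mass u = 1"
  shows "(\<integral>\<^sup>+z. k (fst z - snd z) \<partial>(law u \<Otimes>\<^sub>M law u)) = interaction k u u"
proof -
  interpret prob_space "law u" by (rule prob_space_law) (use assms in auto)
  have "(\<integral>\<^sup>+z. k (fst z - snd z) \<partial>(law u \<Otimes>\<^sub>M law u)) = (\<integral>\<^sup>+x. \<integral>\<^sup>+y. k (x - y) \<partial>law u \<partial>law u)"
    by (subst nn_integral_fst[symmetric]) auto
  also have "\<dots> = (\<integral>\<^sup>+x. ennreal (u x) * (\<integral>\<^sup>+y. k (x - y) \<partial>law u) \<partial>lborel)"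
    by (rule nn_integral_law) measurable
  also have "\<dots> = (\<integral>\<^sup>+x. ennreal (u x) * (\<integral>\<^sup>+y. ennreal (u y) * k (x - y) \<partial>lborel) \<partial>lborel)"
    by (subst nn_integral_law) auto
  also have "\<dots> = (\<integral>\<^sup>+x. \<integral>\<^sup>+y. ennreal (u x) * (ennreal (u y) * k (x - y)) \<partial>lborel \<partial>lborel)"
    by (intro nn_integral_cong nn_integral_cmult[symmetric]) measurable
  also have "\<dots> = interaction k u u" unfolding interaction_def by (simp add: mult_ac)
  finally show ?thesis .
qed

lemma emeasure_law_product:
  fixes u :: "'a::euclidean_space \<Rightarrow> real"
  assumes [measurable]: "u \<in> borel_measurable borel" and "mass u = 1" and A: "A \<in> sets (borel \<Otimes>\<^sub>M borel)"
  shows "emeasure (law u \<Otimes>\<^sub>M law u) A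
    = (\<integral>\<^sup>+x. \<integral>\<^sup>+y. ennreal (u x) * ennreal (u y) * indicator A (x, y) \<partial>lborel \<partial>lborel)"
proof -
  note [measurable] = A
  interpret prob_space "law u" by (rule prob_space_law) (use assms in auto)
  have "A \<in> sets (law u \<Otimes>\<^sub>M law u)" by measurable
  then have "emeasure (law u \<Otimes>\<^sub>M law u) A = (\<integral>\<^sup>+z. indicator A z \<partial>(law u \<Otimes>\<^sub>M law u))"
    by simp
  also have "\<dots> = (\<integral>\<^sup>+x. \<integral>\<^sup>+y. indicator A (x, y) \<partial>law u \<partial>law u)"
    by (subst nn_integral_fst[symmetric]) auto
  also have "\<dots> = (\<integral>\<^sup>+x. ennreal (u x) * (\<integral>\<^sup>+y. indicator A (x, y) \<partial>law u) \<partial>lborel)"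
    by (rule nn_integral_law) measurable
  also have "\<dots> = (\<integral>\<^sup>+x. ennreal (u x) * (\<integral>\<^sup>+y. ennreal (u y) * indicator A (x, y) \<partial>lborel) \<partial>lborel)"
    by (subst nn_integral_law) auto
  also have "\<dots> = (\<integral>\<^sup>+x. \<integral>\<^sup>+y. ennreal (u x) * (ennreal (u y) * indicator A (x, y)) \<partial>lborel \<partial>lborel)"
    by (intro nn_integral_cong nn_integral_cmult[symmetric]) measurable
  finally show ?thesis by (simp add: mult.assoc)
qed

section \<open>Centring, domination and lower semicontinuity\<close>

context aggregation_diffusion
begin

lemma densitiesD:
  assumes "u \<in> densities"
  shows "subdensity u" "mass u = 1" "u \<in> borel_measurable borel" "0 \<le> u x" "power_mass m u < \<infinity>"
  using assms by (auto simp: densities_def subdensity_def)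

text \<open>\<open>nonvanishing\<close> provides a ball with substantial mass, and translation
  invariance moves it to the origin. The point is that \<open>c\<close> and \<open>R\<close> do not
  depend on \<tau>.\<close>

lemma near_maximal_centered:
  obtains c R where "0 < c" "c \<le> 1" "R > 0" "\<And>\<tau>. \<tau> > 0 \<Longrightarrow>
    \<exists>u\<in>densities. Wr u - \<kappa> * Pr u \<ge> J - \<tau> \<and> mass (\<lambda>y. u y * indicator (ball 0 R) y) \<ge> ennreal c"
proof -
  obtain c0 where c0: "c0 \<ge> 0" "\<And>u. subdensity u \<Longrightarrow> 0 \<le> Wr u - \<kappa> * Pr u \<Longrightarrow> Pr u \<le> c0"
    using near_maximal_Pr_bound by blast
  have "J / 4 > 0" using J_pos by simp
  obtain R \<eta> where R: "R > 0" "\<eta> > 0" "\<And>u. subdensity u \<Longrightarrow> power_mass m u \<le> ennreal c0 \<Longrightarrow>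
    (\<And>x. mass (\<lambda>y. u y * indicator (ball x R) y) \<le> ennreal \<eta>) \<Longrightarrow> W u \<le> ennreal (J / 4)"
    using nonvanishing[OF c0(1) \<open>J / 4 > 0\<close>] by blast
  define c where "c = min \<eta> 1"
  have "\<exists>u\<in>densities. Wr u - \<kappa> * Pr u \<ge> J - \<tau> \<and> mass (\<lambda>y. u y * indicator (ball 0 R) y) \<ge> ennreal c"
    if tau: "\<tau> > 0" for \<tau>
  proof -
    \<comment> \<open>The cap \<open>J / 2\<close> keeps the functional above \<open>J / 2\<close>.
      Then \<open>Wr u\<close> exceeds \<open>J / 4\<close>, which contradicts the conclusion of
      \<open>nonvanishing\<close> if no ball is heavy.\<close>
    define \<sigma> where "\<sigma> = min \<tau> (J / 2)"
    have "J - \<sigma> < J" using tau J_pos by (simp add: \<sigma>_def)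
    moreover have "densities \<noteq> {}" using densities_ball by blast
    ultimately obtain u where u: "u \<in> densities" "J - \<sigma> < Wr u - \<kappa> * Pr u"
      unfolding J_def using less_cSUP_iff[OF _ bdd_above_functional] by blast
    note su = densitiesD(1)[OF u(1)]
    have pos: "J / 2 < Wr u - \<kappa> * Pr u" using u(2) unfolding \<sigma>_def by linarith
    then have "Pr u \<le> c0" using J_pos by (intro c0(2) su) simp
    then have P: "power_mass m u \<le> ennreal c0" by (simp add: power_mass_eq_Pr[OF su] ennreal_leI)
    have "J / 4 < Wr u"
    proof -
      have "0 \<le> \<kappa> * Pr u" using kappa_pos Pr_nonneg[of u] by simp
      then show ?thesis using pos J_pos by linarith
    qed
    then have "\<not> W u \<le> ennreal (J / 4)" using J_pos by (simp add: W_eq_Wr[OF su] ennreal_le_iff)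
    then obtain x where x: "\<not> mass (\<lambda>y. u y * indicator (ball x R) y) \<le> ennreal \<eta>"
      using R(3)[OF su P] by blast
    define v where "v = (\<lambda>y. u (x + y))"
    note [measurable] = densitiesD(3)[OF u(1)]
    have [measurable]: "ball z t \<in> sets borel" for z :: 'a and t by simp
    have mv: "mass v = mass u" unfolding mass_def v_def
      by (rule nn_integral_lborel_shift[of "\<lambda>y. ennreal (u y)"]) measurable
    have pv: "power_mass m v = power_mass m u" unfolding power_mass_def v_def
      by (rule nn_integral_lborel_shift[of "\<lambda>y. ennreal (u y powr m)"]) measurable
    have Wv: "W v = W u" unfolding v_def by (rule interaction_shift) measurable
    have "v \<in> borel_measurable borel" unfolding v_def by measurable
    then have "v \<in> densities"
      using densitiesD[OF u(1)] mv pv by (simp add: densities_def subdensity_def v_def)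
    moreover have "Wr v - \<kappa> * Pr v \<ge> J - \<tau>"
      using u(2) unfolding Wr_def Pr_def Wv pv \<sigma>_def by simp
    moreover have "mass (\<lambda>y. v y * indicator (ball 0 R) y) = mass (\<lambda>y. u y * indicator (ball x R) y)"
    proof -
      have "indicator (ball 0 R) y = (indicator (ball x R) (x + y) :: real)" for y :: 'a
        by (simp add: indicator_def dist_norm)
      then have "mass (\<lambda>y. v y * indicator (ball 0 R) y) = (\<integral>\<^sup>+y. ennreal (u (x + y) * indicator (ball x R) (x + y)) \<partial>lborel)"
        by (simp add: mass_def v_def)
      also have "\<dots> = mass (\<lambda>y. u y * indicator (ball x R) y)" unfolding mass_def
        by (rule nn_integral_lborel_shift[of "\<lambda>y. ennreal (u y * indicator (ball x R) y)"]) measurable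
      finally show ?thesis .
    qed
    moreover have "ennreal c \<le> mass (\<lambda>y. u y * indicator (ball x R) y)"
    proof -
      have "ennreal c \<le> ennreal \<eta>" by (intro ennreal_leI) (simp add: c_def)
      then show ?thesis using x by (simp add: not_le)
    qed
    ultimately show ?thesis by auto
  qed
  moreover have "0 < c" "c \<le> 1" using R(2) by (auto simp: c_def)
  ultimately show ?thesis using that R(1) by blast
qed

text \<open>A product of two values of \<open>u\<close> exceeds \<open>L\<^sup>2\<close> on a ball only if one of the factors
  belongs to the part \<open>b\<close> of small mass.\<close>

lemma law_product_dominated:
  assumes u: "u \<in> densities" and L: "L > 0" and out: "mass (\<lambda>y. u y * indicator (- ball 0 R) y) \<le> ennreal \<delta>"
    and \<delta>: "\<delta> \<ge> 0" and P: "L powr (1 - m) * Pr u \<le> \<delta>" and A: "A \<in> sets (borel \<Otimes>\<^sub>M borel)"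
  shows "emeasure (law u \<Otimes>\<^sub>M law u) A \<le> emeasure (density (lborel \<Otimes>\<^sub>M lborel)
      (\<lambda>z. ennreal (L\<^sup>2) * indicator (ball 0 R \<times> ball 0 R) z)) A + ennreal (4 * \<delta>)"
proof -
  note [measurable] = densitiesD(3)[OF u] A
  have [measurable]: "ball z t \<in> sets borel" for z :: 'a and t by simp
  define B where "B = ball (0::'a) R"
  have [measurable]: "B \<in> sets borel" by (simp add: B_def)
  \<comment> \<open>\<open>b\<close> has mass at most 2\<delta>: one \<delta> for the outside of the
    ball and one for the values above \<open>L\<close>. Either factor of the product may be the bad
    one, hence 4\<delta>.\<close>
  define b where "b x = (if u x \<le> L \<and> x \<in> B then 0 else u x)" for x
  have [measurable]: "b \<in> borel_measurable borel" unfolding b_def by measurable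
  have u0: "0 \<le> u x" for x by (rule densitiesD[OF u])
  have b0: "0 \<le> b x" for x using u0 by (simp add: b_def)
  have "b x \<le> u x * indicator (- B) x + L powr (1 - m) * u x powr m" for x
  proof (cases "u x \<le> L")
    case True then show ?thesis using u0[of x] by (simp add: b_def)
  next
    case False
    then have ux: "u x > 0" using L by simp
    have "u x = u x powr (1 - m) * u x powr m" using ux by (simp add: powr_add[symmetric])
    also have "\<dots> \<le> L powr (1 - m) * u x powr m"
      using False L m_gt_1 by (intro mult_right_mono powr_mono2') auto
    finally show ?thesis using ux by (auto simp: b_def indicator_def)
  qed
  then have "mass b \<le> (\<integral>\<^sup>+x. ennreal (u x * indicator (- B) x + L powr (1 - m) * u x powr m) \<partial>lborel)"
    unfolding mass_def by (intro nn_integral_mono ennreal_leI)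
  also have "\<dots> = (\<integral>\<^sup>+x. ennreal (u x * indicator (- B) x) + ennreal (L powr (1 - m)) * ennreal (u x powr m) \<partial>lborel)"
    using u0 by (simp add: ennreal_mult)
  also have "\<dots> = mass (\<lambda>x. u x * indicator (- B) x) + ennreal (L powr (1 - m)) * power_mass m u"
    unfolding mass_def power_mass_def by (subst nn_integral_add) (auto simp: nn_integral_cmult)
  also have "\<dots> \<le> ennreal \<delta> + ennreal \<delta>"
  proof (rule add_mono)
    show "mass (\<lambda>x. u x * indicator (- B) x) \<le> ennreal \<delta>" using out by (simp add: B_def)
    show "ennreal (L powr (1 - m)) * power_mass m u \<le> ennreal \<delta>"
      using P unfolding power_mass_eq_Pr[OF densitiesD(1)[OF u]]
      by (simp add: ennreal_mult[symmetric] Pr_nonneg ennreal_leI)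
  qed
  also have "\<dots> = ennreal (2 * \<delta>)" using \<delta> by (simp add: ennreal_plus[symmetric] del: ennreal_plus)
  finally have mb: "mass b \<le> ennreal (2 * \<delta>)" .
  have pt: "ennreal (u x) * ennreal (u y) * indicator A (x, y)
      \<le> ennreal (L\<^sup>2) * indicator (B \<times> B) (x, y) * indicator A (x, y) + (1 * (ennreal (b x) * ennreal (u y)) + 1 * (ennreal (u x) * ennreal (b y)))" for x y
  proof (cases "u x \<le> L \<and> x \<in> B \<and> u y \<le> L \<and> y \<in> B")
    case True
    then have "u x * u y \<le> L\<^sup>2" unfolding power2_eq_square using u0 L by (intro mult_mono) auto
    then have "ennreal (u x) * ennreal (u y) \<le> ennreal (L\<^sup>2)"
      using u0 by (simp add: ennreal_mult[symmetric] ennreal_leI)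
    then show ?thesis using True by (auto simp: indicator_def intro: add_increasing2)
  next
    case False
    then have "b x = u x \<or> b y = u y" by (auto simp: b_def)
    then show ?thesis by (auto simp: indicator_def intro: add_increasing add_increasing2)
  qed
  have "emeasure (law u \<Otimes>\<^sub>M law u) A = (\<integral>\<^sup>+x. \<integral>\<^sup>+y. ennreal (u x) * ennreal (u y) * indicator A (x, y) \<partial>lborel \<partial>lborel)"
    by (rule emeasure_law_product) (use densitiesD[OF u] in auto)
  also have "\<dots> \<le> (\<integral>\<^sup>+x. \<integral>\<^sup>+y. ennreal (L\<^sup>2) * indicator (B \<times> B) (x, y) * indicator A (x, y)
      + (1 * (ennreal (b x) * ennreal (u y)) + 1 * (ennreal (u x) * ennreal (b y))) \<partial>lborel \<partial>lborel)"
    by (intro nn_integral_mono pt)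
  also have "\<dots> = (\<integral>\<^sup>+x. \<integral>\<^sup>+y. ennreal (L\<^sup>2) * indicator (B \<times> B) (x, y) * indicator A (x, y) \<partial>lborel \<partial>lborel)
      + (interaction (\<lambda>_. 1) b u + interaction (\<lambda>_. 1) u b)"
    unfolding interaction_def by (simp add: nn_integral_add)
  also have "interaction (\<lambda>_. 1) b u + interaction (\<lambda>_. 1) u b = mass b + mass b"
    by (simp add: interaction_const densitiesD(2)[OF u])
  also have "(\<integral>\<^sup>+x. \<integral>\<^sup>+y. ennreal (L\<^sup>2) * indicator (B \<times> B) (x, y) * indicator A (x, y) \<partial>lborel \<partial>lborel)
      = (\<integral>\<^sup>+z. ennreal (L\<^sup>2) * indicator (B \<times> B) z * indicator A z \<partial>(lborel \<Otimes>\<^sub>M lborel))"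
    by (rule lborel.nn_integral_fst) measurable
  also have "\<dots> = emeasure (density (lborel \<Otimes>\<^sub>M lborel) (\<lambda>z. ennreal (L\<^sup>2) * indicator (B \<times> B) z)) A"
    by (subst emeasure_density) auto
  also have "\<dots> + (mass b + mass b) \<le> \<dots> + (ennreal (2 * \<delta>) + ennreal (2 * \<delta>))"
    by (intro add_left_mono add_mono mb)
  also have "ennreal (2 * \<delta>) + ennreal (2 * \<delta>) = ennreal (4 * \<delta>)"
    using \<delta> by (simp add: ennreal_plus[symmetric] del: ennreal_plus)
  finally show ?thesis by (simp add: B_def)
qed

text \<open>The tangent line at \<open>y\<close> to the convex function \<open>x powr m\<close>:
  linear in \<open>x\<close>, as is needed for testing against a measure.\<close>

lemma powr_young:
  assumes "0 \<le> x" "0 \<le> y"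
  shows "m * (y powr (m - 1) * x) \<le> x powr m + (m - 1) * y powr m"
proof (cases "x = 0 \<or> y = 0")
  case True
  then show ?thesis using m_gt_1 by auto
next
  case False
  then have xy: "x > 0" "y > 0" using assms by auto
  have "(x powr m) powr (1 / m) * (y powr m) powr (1 - 1 / m) \<le> 1 / m * x powr m + (1 - 1 / m) * y powr m"
    using xy m_gt_1 by (intro Youngs_inequality_0) auto
  moreover have "m * (1 - 1 / m) = m - 1" using m_gt_1 by (simp add: field_simps)
  then have "(y powr m) powr (1 - 1 / m) = y powr (m - 1)" by (simp add: powr_powr)
  moreover have "(x powr m) powr (1 / m) = x" using xy m_gt_1 by (simp add: powr_powr)
  ultimately have "m * (x * y powr (m - 1)) \<le> m * (1 / m * x powr m + (1 - 1 / m) * y powr m)"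
    using m_gt_1 by (intro mult_left_mono) auto
  also have "\<dots> = x powr m + (m - 1) * y powr m" using m_gt_1 by (simp add: field_simps)
  finally show ?thesis by (simp add: mult_ac)
qed

text \<open>Young's inequality bounds \<open>\<integral>w\<^sup>m\<close> from below by an affine function of \<open>w\<close>, which passes to the
  setwise limit; the truncations \<open>g\<close> of the limit density are the optimal choices.\<close>

lemma power_mass_setwise_lsc:
  assumes G: "G \<noteq> bot" and w: "\<And>n::nat. w n \<in> densities"
    and [measurable]: "u \<in> borel_measurable borel" and u: "\<And>x. 0 \<le> u x" "mass u = 1"
    and lim: "\<And>A. A \<in> sets borel \<Longrightarrow> ((\<lambda>n. measure (law (w n)) A) \<longlongrightarrow> measure (law u) A) G"
    and p: "\<forall>\<^sub>F n in G. Pr (w n) \<le> p"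
  shows "power_mass m u \<le> ennreal p"
proof -
  \<comment> \<open>Truncation in height makes the test function \<open>f\<close> bounded, as
    setwise convergence requires. With the truncation in space, the power mass \<open>q\<close> of
    \<open>g k\<close> is finite, so that it can be cancelled in
    \<open>m * q \<le> p + (m - 1) * q\<close>.\<close>
  define g where "g k x = min (u x) (real k) * indicator (ball 0 (real k)) x" for k x
  have [measurable]: "ball z t \<in> sets borel" for z :: 'a and t by simp
  have [measurable]: "g k \<in> borel_measurable borel" for k unfolding g_def by measurable
  have g: "0 \<le> g k x" "g k x \<le> u x" "g k x \<le> real k" for k x
    using u(1)[of x] by (auto simp: g_def indicator_def)
  have *: "power_mass m (g k) \<le> ennreal p" for k
  proof -
    define f where "f x = g k x powr (m - 1)" for x
    have [measurable]: "f \<in> borel_measurable borel" unfolding f_def by measurable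
    \<comment> \<open>The summand 1 keeps the bound strictly positive for \<open>k = 0\<close> too,
      as \<open>setwise_limit_integral\<close> demands.\<close>
    have f: "0 \<le> f x" "f x \<le> real k powr (m - 1) + 1" for x
      using g[of k x] m_gt_1 by (auto simp: f_def intro!: add_increasing2 powr_mono2)
    have "power_mass m (g k) \<le> (\<integral>\<^sup>+x. ennreal (real k powr m) * indicator (ball (0::'a) (real k)) x \<partial>lborel)"
      unfolding power_mass_def using g(1,3) m_gt_1 u(1)
      by (intro nn_integral_mono) (auto simp: g_def indicator_def intro!: ennreal_leI powr_mono2)
    also have "\<dots> < \<infinity>"
      by (simp add: nn_integral_cmult_indicator emeasure_ball ennreal_mult_less_top)
    finally have fin: "power_mass m (g k) < \<infinity>" .
    define q where "q = enn2real (power_mass m (g k))"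
    have q: "power_mass m (g k) = ennreal q" "q \<ge> 0" using fin by (auto simp: q_def less_top)
    have upper: "m * integral\<^sup>L (law (w n)) f \<le> Pr (w n) + (m - 1) * q" for n
    proof -
      note [measurable] = densitiesD(3)[OF w[of n]]
      interpret prob_space "law (w n)" by (rule prob_space_law) (use densitiesD[OF w] in auto)
      have "integrable (law (w n)) f"
        by (rule integrable_const_bound[where B="real k powr (m - 1) + 1"]) (use f in auto)
      then have "ennreal (integral\<^sup>L (law (w n)) f) = (\<integral>\<^sup>+x. ennreal (f x) \<partial>law (w n))"
        using f(1) by (intro nn_integral_eq_integral[symmetric]) auto
      also have "\<dots> = (\<integral>\<^sup>+x. ennreal (w n x) * ennreal (f x) \<partial>lborel)"
        by (rule nn_integral_law) measurable
      finally have "ennreal m * ennreal (integral\<^sup>L (law (w n)) f) = ennreal m * (\<integral>\<^sup>+x. ennreal (w n x) * ennreal (f x) \<partial>lborel)"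
        by simp
      also have "\<dots> = (\<integral>\<^sup>+x. ennreal m * (ennreal (w n x) * ennreal (f x)) \<partial>lborel)"
        by (intro nn_integral_cmult[symmetric]) measurable
      also have "\<dots> \<le> (\<integral>\<^sup>+x. ennreal (w n x powr m) + ennreal (m - 1) * ennreal (g k x powr m) \<partial>lborel)"
      proof (intro nn_integral_mono)
        fix x
        have "m * (w n x * f x) \<le> w n x powr m + (m - 1) * g k x powr m"
          using powr_young[of "w n x" "g k x"] densitiesD(4)[OF w, of n x] g(1) by (simp add: f_def mult_ac)
        then have "ennreal (m * (w n x * f x)) \<le> ennreal (w n x powr m + (m - 1) * g k x powr m)"
          by (rule ennreal_leI)
        then show "ennreal m * (ennreal (w n x) * ennreal (f x)) \<le> ennreal (w n x powr m) + ennreal (m - 1) * ennreal (g k x powr m)"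
          using m_gt_1 densitiesD(4)[OF w, of n x] f(1) by (simp add: ennreal_mult)
      qed
      also have "\<dots> = power_mass m (w n) + ennreal (m - 1) * power_mass m (g k)"
        unfolding power_mass_def by (subst nn_integral_add) (auto simp: nn_integral_cmult)
      also have "\<dots> = ennreal (Pr (w n) + (m - 1) * q)"
        using m_gt_1 q(2) Pr_nonneg by (simp add: q(1) power_mass_eq_Pr[OF densitiesD(1)[OF w]] ennreal_mult)
      finally have "ennreal (m * integral\<^sup>L (law (w n)) f) \<le> ennreal (Pr (w n) + (m - 1) * q)"
        using m_gt_1 f(1) by (simp add: ennreal_mult)
      then show ?thesis
        using m_gt_1 q(2) Pr_nonneg[of "w n"] by (subst (asm) ennreal_le_iff) auto
    qed
    have lower: "q \<le> integral\<^sup>L (law u) f"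
    proof -
      interpret prob_space "law u" by (rule prob_space_law) (use u in auto)
      have "integrable (law u) f"
        by (rule integrable_const_bound[where B="real k powr (m - 1) + 1"]) (use f in auto)
      then have "ennreal (integral\<^sup>L (law u) f) = (\<integral>\<^sup>+x. ennreal (f x) \<partial>law u)"
        using f(1) by (intro nn_integral_eq_integral[symmetric]) auto
      also have "\<dots> = (\<integral>\<^sup>+x. ennreal (u x) * ennreal (f x) \<partial>lborel)"
        by (rule nn_integral_law) measurable
      also have "\<dots> \<ge> power_mass m (g k)"
        unfolding power_mass_def
      proof (intro nn_integral_mono)
        fix x
        have "g k x powr m = g k x * f x"
          using g(1)[of k x] by (cases "g k x = 0") (auto simp: f_def powr_diff)
        also have "\<dots> \<le> u x * f x" by (intro mult_right_mono g f)
        finally show "ennreal (g k x powr m) \<le> ennreal (u x) * ennreal (f x)"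
          using u(1) f(1) by (simp add: ennreal_mult[symmetric] ennreal_leI)
      qed
      finally have "ennreal q \<le> ennreal (integral\<^sup>L (law u) f)" using q(1) by simp
      then show ?thesis using f(1) by (subst (asm) ennreal_le_iff) auto
    qed
    have "((\<lambda>n. integral\<^sup>L (law (w n)) f) \<longlongrightarrow> integral\<^sup>L (law u) f) G"
    proof (rule setwise_limit_integral[where M=borel and b="real k powr (m - 1) + 1"])
      show "prob_space (law (w n))" for n by (rule prob_space_law) (use densitiesD[OF w] in auto)
      show "prob_space (law u)" by (rule prob_space_law) (use u in auto)
      show "0 < real k powr (m - 1) + 1" by (simp add: add_nonneg_pos)
    qed (use lim f in auto)
    then have "((\<lambda>n. m * integral\<^sup>L (law (w n)) f) \<longlongrightarrow> m * integral\<^sup>L (law u) f) G"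
      by (intro tendsto_intros)
    moreover have "\<forall>\<^sub>F n in G. m * integral\<^sup>L (law (w n)) f \<le> p + (m - 1) * q"
      using p
    proof eventually_elim
      case (elim n)
      then show ?case using upper[of n] by linarith
    qed
    ultimately have "m * integral\<^sup>L (law u) f \<le> p + (m - 1) * q"
      by (rule tendsto_upperbound[OF _ _ G])
    moreover have "m * q \<le> m * integral\<^sup>L (law u) f" using lower m_gt_1 by (intro mult_left_mono) auto
    ultimately have "q \<le> p" by (simp add: left_diff_distrib)
    then show ?thesis unfolding q(1) by (rule ennreal_leI)
  qed
  have "(\<lambda>k. ennreal (g k x powr m)) \<longlonglongrightarrow> ennreal (u x powr m)" for x
  proof (rule tendsto_eventually)
    obtain K where K: "real K > max (u x) (norm x)" using reals_Archimedean2 by blast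
    have "g k x = u x" if "k \<ge> K" for k
    proof -
      have "real k > max (u x) (norm x)" using K that by (metis of_nat_le_iff order_less_le_trans)
      then show ?thesis by (simp add: g_def)
    qed
    then show "\<forall>\<^sub>F k in sequentially. ennreal (g k x powr m) = ennreal (u x powr m)"
      by (auto simp: eventually_sequentially intro!: exI[of _ K])
  qed
  then have "liminf (\<lambda>k. ennreal (g k x powr m)) = ennreal (u x powr m)" for x
    by (intro lim_imp_Liminf trivial_limit_sequentially)
  then have "power_mass m u = (\<integral>\<^sup>+x. liminf (\<lambda>k. ennreal (g k x powr m)) \<partial>lborel)"
    unfolding power_mass_def by simp
  also have "\<dots> \<le> liminf (\<lambda>k. power_mass m (g k))"
    unfolding power_mass_def by (intro nn_integral_liminf) measurable
  also have "\<dots> \<le> liminf (\<lambda>k. ennreal p)"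
    by (intro Liminf_mono always_eventually allI *)
  finally show ?thesis by (simp add: Liminf_const)
qed

end

text \<open>On rectangles the product measure is a product of two convergent numbers, so the limit
  factorises there; a measure on the product space with \<sigma>-finite factors is determined by its
  rectangles.\<close>

lemma product_of_marginal:
  fixes \<nu> :: "('a::euclidean_space \<times> 'a) measure"
  assumes G: "G \<noteq> bot" and prob: "\<And>n::nat. prob_space (\<rho> n)" and sets_\<rho>: "\<And>n. sets (\<rho> n) = sets borel"
    and \<nu>: "prob_space \<nu>" "sets \<nu> = sets (borel \<Otimes>\<^sub>M borel)"
    and lim: "\<And>A. A \<in> sets (borel \<Otimes>\<^sub>M borel) \<Longrightarrow> ((\<lambda>n. measure (\<rho> n \<Otimes>\<^sub>M \<rho> n) A) \<longlongrightarrow> measure \<nu> A) G"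
  obtains \<mu> where "prob_space \<mu>" "sets \<mu> = sets borel" "\<nu> = \<mu> \<Otimes>\<^sub>M \<mu>"
    "\<And>A. A \<in> sets borel \<Longrightarrow> ((\<lambda>n. measure (\<rho> n) A) \<longlongrightarrow> measure \<mu> A) G"
proof -
  \<comment> \<open>The first marginal serves as the limit of the factors, because
    \<open>A \<times> UNIV\<close> has product measure \<open>measure (\<rho> n) A\<close>.\<close>
  define \<mu> where "\<mu> = distr \<nu> borel fst"
  have fst_meas: "fst \<in> measurable \<nu> borel"
    using \<nu>(2) by (simp cong: measurable_cong_sets)
  interpret N: prob_space \<nu> by fact
  have \<mu>: "prob_space \<mu>" unfolding \<mu>_def by (rule N.prob_space_distr[OF fst_meas])
  have sets_\<mu>: "sets \<mu> = sets borel" by (simp add: \<mu>_def)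
  interpret P: prob_space \<mu> by fact
  have rect: "measure (\<rho> n \<Otimes>\<^sub>M \<rho> n) (A \<times> B) = measure (\<rho> n) A * measure (\<rho> n) B"
    if "A \<in> sets borel" "B \<in> sets borel" for n A B
  proof -
    interpret prob_space "\<rho> n" by (rule prob)
    show ?thesis using that sets_\<rho>[of n]
      by (simp add: measure_def emeasure_pair_measure_Times enn2real_mult)
  qed
  have total: "measure (\<rho> n) UNIV = 1" for n
    using prob_space.prob_space[OF prob[of n]] sets_eq_imp_space_eq[OF sets_\<rho>[of n]] by simp
  have marg: "((\<lambda>n. measure (\<rho> n) A) \<longlongrightarrow> measure \<mu> A) G" if A: "A \<in> sets borel" for A
  proof -
    have "space \<nu> = UNIV" using sets_eq_imp_space_eq[OF \<nu>(2)] by (simp add: space_pair_measure)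
    then have "measure \<mu> A = measure \<nu> (A \<times> UNIV)"
      unfolding \<mu>_def by (subst measure_distr[OF fst_meas]) (use A in \<open>auto intro!: arg_cong[where f="measure \<nu>"]\<close>)
    then show ?thesis using lim[of "A \<times> UNIV"] rect[OF A, of UNIV] A by (simp add: total)
  qed
  have "\<mu> \<Otimes>\<^sub>M \<mu> = \<nu>"
  proof (rule pair_measure_eqI)
    show "sets (\<mu> \<Otimes>\<^sub>M \<mu>) = sets \<nu>"
      unfolding \<nu>(2) by (rule sets_pair_measure_cong[OF sets_\<mu> sets_\<mu>])
    fix A B assume "A \<in> sets \<mu>" "B \<in> sets \<mu>"
    then have AB: "A \<in> sets borel" "B \<in> sets borel" by (auto simp: sets_\<mu>)
    have "((\<lambda>n. measure (\<rho> n) A * measure (\<rho> n) B) \<longlongrightarrow> measure \<mu> A * measure \<mu> B) G"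
      by (intro tendsto_mult marg AB)
    moreover have "((\<lambda>n. measure (\<rho> n) A * measure (\<rho> n) B) \<longlongrightarrow> measure \<nu> (A \<times> B)) G"
      using lim[of "A \<times> B"] rect[OF AB] AB by simp
    ultimately have "measure \<mu> A * measure \<mu> B = measure \<nu> (A \<times> B)" by (rule tendsto_unique[OF G])
    then show "emeasure \<mu> A * emeasure \<mu> B = emeasure \<nu> (A \<times> B)"
      by (simp add: P.emeasure_eq_measure N.emeasure_eq_measure ennreal_mult[symmetric])
  qed (rule P.sigma_finite_measure_axioms)+
  then show ?thesis using that[OF \<mu> sets_\<mu>] marg by simp
qed

lemma law_of_absolutely_continuous:
  fixes \<mu> :: "'a::euclidean_space measure"
  assumes "prob_space \<mu>" "sets \<mu> = sets borel" "absolutely_continuous lborel \<mu>"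
  defines "u \<equiv> \<lambda>x. enn2real (RN_deriv lborel \<mu> x)"
  shows "u \<in> borel_measurable borel" "\<mu> = law u" "mass u = 1"
proof -
  interpret prob_space \<mu> by fact
  have [measurable]: "RN_deriv lborel \<mu> \<in> borel_measurable borel"
    using borel_measurable_RN_deriv[of lborel \<mu>] by simp
  show [measurable]: "u \<in> borel_measurable borel" unfolding u_def by measurable
  have "AE x in lborel. RN_deriv lborel \<mu> x \<noteq> \<infinity>"
    by (rule sigma_finite_measure.RN_deriv_finite[OF sigma_finite_lborel]) (use assms sigma_finite_measure_axioms in auto)
  then have "AE x in lborel. RN_deriv lborel \<mu> x = ennreal (u x)"
    by eventually_elim (simp add: u_def less_top)
  then have "density lborel (RN_deriv lborel \<mu>) = density lborel (\<lambda>x. ennreal (u x))"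
    by (intro density_cong) auto
  then show \<mu>: "\<mu> = law u"
    using sigma_finite_measure.density_RN_deriv[OF sigma_finite_lborel, of \<mu>] assms by (simp add: law_def)
  have "mass u = emeasure (law u) UNIV"
    unfolding law_def mass_def by (subst emeasure_density) auto
  also have "\<dots> = 1" using emeasure_space_1 unfolding \<mu> by simp
  finally show "mass u = 1" .
qed

section \<open>Passage to the limit along a maximising sequence\<close>

context aggregation_diffusion
begin

text \<open>This is the domination hypothesis of \<open>setwise_cluster_point\<close> for the
  product measures. It is asserted only eventually because the tightness radius belongs to a
  threshold \<tau>, which the sequence meets from some index on.\<close>

lemma law_sequence_dominated:
  assumes w: "\<And>n::nat. w n \<in> densities"
    and near_max: "\<And>n. Wr (w n) - \<kappa> * Pr (w n) \<ge> J - 1 / real (Suc n)"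
    and c: "0 < c" "c \<le> 1" and R: "R > 0"
    and centre: "\<And>n. mass (\<lambda>y. w n y * indicator (ball 0 R) y) \<ge> ennreal c" and \<delta>: "\<delta> > 0"
  shows "\<exists>\<Lambda>. finite_measure \<Lambda> \<and> sets \<Lambda> = sets (borel \<Otimes>\<^sub>M borel) \<and>
    (\<forall>\<^sub>F n in sequentially. \<forall>A\<in>sets (borel \<Otimes>\<^sub>M borel). measure (law (w n) \<Otimes>\<^sub>M law (w n)) A \<le> measure \<Lambda> A + \<delta>)"
proof -
  obtain c0 where c0: "c0 \<ge> 0" "\<And>u. subdensity u \<Longrightarrow> 0 \<le> Wr u - \<kappa> * Pr u \<Longrightarrow> Pr u \<le> c0"
    using near_maximal_Pr_bound by blast
  have d4: "\<delta> / 4 > 0" using \<delta> by simp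
  obtain \<tau> R' where \<tau>: "\<tau> > 0" "R' > 0" "\<And>u x. u \<in> densities \<Longrightarrow> Wr u - \<kappa> * Pr u \<ge> J - \<tau> \<Longrightarrow>
    mass (\<lambda>y. u y * indicator (ball x R) y) \<ge> ennreal c \<Longrightarrow>
    mass (\<lambda>y. u y * indicator (- ball x R') y) \<le> ennreal (\<delta> / 4)"
    using near_maximal_tight[OF c R d4] by blast
  \<comment> \<open>\<open>L\<close> solves \<open>L powr (1 - m) * (c0 + 1) = \<delta> / 4\<close>,
    so the mass above height \<open>L\<close> is at most \<delta>/4 whenever \<open>Pr\<close> is at
    most \<open>c0\<close>.\<close>
  define L where "L = (\<delta> / 4 / (c0 + 1)) powr (1 / (1 - m))"
  have L: "L > 0" using \<delta> c0(1) by (simp add: L_def)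
  have "L powr (1 - m) = \<delta> / 4 / (c0 + 1)"
    unfolding L_def powr_powr using m_gt_1 \<delta> c0(1) by simp
  then have L_eq: "L powr (1 - m) * (c0 + 1) = \<delta> / 4"
    using c0(1) by (subst (asm) nonzero_eq_divide_eq) auto
  define \<Lambda> where "\<Lambda> = density (lborel \<Otimes>\<^sub>M lborel) (\<lambda>z::'a \<times> 'a. ennreal (L\<^sup>2) * indicator (ball 0 R' \<times> ball 0 R') z)"
  have [measurable]: "ball (0::'a) R' \<in> sets borel" by simp
  have sets_\<Lambda>: "sets \<Lambda> = sets (borel \<Otimes>\<^sub>M borel)"
    unfolding \<Lambda>_def sets_density by (rule sets_pair_measure_cong) auto
  have space_\<Lambda>: "space \<Lambda> = UNIV" by (simp add: \<Lambda>_def space_pair_measure)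
  have [measurable]: "(UNIV :: ('a \<times> 'a) set) \<in> sets (borel \<Otimes>\<^sub>M borel)"
    using sets.top[of "borel \<Otimes>\<^sub>M borel"] by (simp add: space_pair_measure)
  have "emeasure \<Lambda> (space \<Lambda>) = ennreal (L\<^sup>2) * emeasure (lborel \<Otimes>\<^sub>M lborel) (ball (0::'a) R' \<times> ball (0::'a) R')"
    unfolding space_\<Lambda> unfolding \<Lambda>_def by (subst emeasure_density) (auto simp: nn_integral_cmult_indicator)
  also have "\<dots> = ennreal (L\<^sup>2) * (emeasure lborel (ball (0::'a) R') * emeasure lborel (ball (0::'a) R'))"
    by (subst lborel.emeasure_pair_measure_Times) auto
  also have "\<dots> < \<infinity>" using \<tau>(2) by (simp add: emeasure_ball ennreal_mult_less_top)
  finally have fin: "finite_measure \<Lambda>" by (intro finite_measureI) simp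
  interpret L: finite_measure \<Lambda> by fact
  \<comment> \<open>Being below \<tau> gives tightness; being below \<open>J\<close> makes the
    functional nonnegative and so bounds \<open>Pr (w n)\<close>.\<close>
  have "\<forall>\<^sub>F n in sequentially. 1 / real (Suc n) < min \<tau> J"
    using order_tendstoD(2)[OF lim_inverse_n', of "min \<tau> J"] \<tau>(1) J_pos
    by (subst eventually_sequentially_Suc[of "\<lambda>n. 1 / real n < min \<tau> J"]) (auto simp: inverse_eq_divide)
  then have "\<forall>\<^sub>F n in sequentially. \<forall>A\<in>sets (borel \<Otimes>\<^sub>M borel). measure (law (w n) \<Otimes>\<^sub>M law (w n)) A \<le> measure \<Lambda> A + \<delta>"
  proof eventually_elim
    case (elim n)
    interpret prob_space "law (w n)" by (rule prob_space_law) (use densitiesD[OF w] in auto)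
    interpret pair_prob_space "law (w n)" "law (w n)" ..
    have out: "mass (\<lambda>y. w n y * indicator (- ball 0 R') y) \<le> ennreal (\<delta> / 4)"
      by (rule \<tau>(3)[OF w _ centre]) (use near_max[of n] elim in linarith)
    have "Pr (w n) \<le> c0"
      by (rule c0(2)[OF densitiesD(1)[OF w]]) (use near_max[of n] elim in linarith)
    then have "L powr (1 - m) * Pr (w n) \<le> L powr (1 - m) * (c0 + 1)" by (intro mult_left_mono) auto
    then have P: "L powr (1 - m) * Pr (w n) \<le> \<delta> / 4" unfolding L_eq .
    show ?case
    proof
      fix A :: "('a \<times> 'a) set" assume A: "A \<in> sets (borel \<Otimes>\<^sub>M borel)"
      have "emeasure (law (w n) \<Otimes>\<^sub>M law (w n)) A \<le> emeasure \<Lambda> A + ennreal (4 * (\<delta> / 4))"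
        unfolding \<Lambda>_def by (rule law_product_dominated[OF w L out _ P A]) (use \<delta> in simp)
      then have "ennreal (measure (law (w n) \<Otimes>\<^sub>M law (w n)) A) \<le> ennreal (measure \<Lambda> A + \<delta>)"
        using \<delta> by (simp add: P.emeasure_eq_measure L.emeasure_eq_measure)
      then show "measure (law (w n) \<Otimes>\<^sub>M law (w n)) A \<le> measure \<Lambda> A + \<delta>"
        using \<delta> by (subst (asm) ennreal_le_iff) (auto simp: add_nonneg_nonneg)
    qed
  qed
  then show ?thesis using fin sets_\<Lambda> by blast
qed

lemma maximiser_exists: "\<exists>u\<in>densities. Wr u - \<kappa> * Pr u = J"
proof -
  obtain c R where c: "0 < c" "c \<le> 1" and R: "R > 0" and ex: "\<And>\<tau>. \<tau> > 0 \<Longrightarrow>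
    \<exists>u\<in>densities. Wr u - \<kappa> * Pr u \<ge> J - \<tau> \<and> mass (\<lambda>y. u y * indicator (ball 0 R) y) \<ge> ennreal c"
    using near_maximal_centered by blast
  have "\<exists>u. u \<in> densities \<and> Wr u - \<kappa> * Pr u \<ge> J - 1 / real (Suc n) \<and> mass (\<lambda>y. u y * indicator (ball 0 R) y) \<ge> ennreal c" for n
    using ex[of "1 / real (Suc n)"] by auto
  then obtain w where w: "\<And>n. w n \<in> densities" and near_max: "\<And>n. Wr (w n) - \<kappa> * Pr (w n) \<ge> J - 1 / real (Suc n)"
    and centre: "\<And>n. mass (\<lambda>y. w n y * indicator (ball 0 R) y) \<ge> ennreal c"
    by metis
  have prob: "prob_space (law (w n))" for n by (rule prob_space_law) (use densitiesD[OF w] in auto)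
  have prob2: "prob_space (law (w n) \<Otimes>\<^sub>M law (w n))" for n by (intro prob_space_pair prob)
  have sets2: "sets (law (w n) \<Otimes>\<^sub>M law (w n)) = sets (borel \<Otimes>\<^sub>M borel)" for n
    by (intro sets_pair_measure_cong) auto
  obtain G \<nu> where G: "G \<noteq> bot" "G \<le> sequentially" and \<nu>: "prob_space \<nu>" "sets \<nu> = sets (borel \<Otimes>\<^sub>M borel)"
    and lim2: "\<And>A. A \<in> sets (borel \<Otimes>\<^sub>M borel) \<Longrightarrow> ((\<lambda>n. measure (law (w n) \<Otimes>\<^sub>M law (w n)) A) \<longlongrightarrow> measure \<nu> A) G"
    using setwise_cluster_point[OF prob2 sets2 law_sequence_dominated[OF w near_max c R centre]] by blast
  obtain \<mu> where \<mu>: "prob_space \<mu>" "sets \<mu> = sets borel" "\<nu> = \<mu> \<Otimes>\<^sub>M \<mu>"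
    and lim: "\<And>A. A \<in> sets borel \<Longrightarrow> ((\<lambda>n. measure (law (w n)) A) \<longlongrightarrow> measure \<mu> A) G"
    using product_of_marginal[OF G(1) prob sets_law \<nu> lim2] by blast
  \<comment> \<open>Setwise limits preserve null sets: each Lebesgue null set has measure 0 under
    every \<open>law (w n)\<close>.\<close>
  have "absolutely_continuous lborel \<mu>"
    unfolding absolutely_continuous_def
  proof
    fix A :: "'a set" assume A: "A \<in> null_sets lborel"
    then have "A \<in> null_sets (law (w n))" for n
      using absolutely_continuousI_density[of "\<lambda>x. ennreal (w n x)" lborel] densitiesD(3)[OF w[of n]]
      unfolding law_def absolutely_continuous_def by auto
    then have "measure (law (w n)) A = 0" for n by (simp add: measure_eq_0_null_sets)
    moreover have Ab: "A \<in> sets borel" using null_setsD2[OF A] by simp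
    ultimately have "measure \<mu> A = 0"
      using lim[OF Ab] tendsto_unique[OF G(1) _ tendsto_const, of 0] by simp
    then show "A \<in> null_sets \<mu>"
      using A \<mu>(1,2) by (auto simp: null_sets_def finite_measure.emeasure_eq_measure[OF prob_space.finite_measure])
  qed
  note ac = this
  define u where "u = (\<lambda>x. enn2real (RN_deriv lborel \<mu> x))"
  have u_meas[measurable]: "u \<in> borel_measurable borel" and u: "\<mu> = law u" "mass u = 1"
    unfolding u_def by (fact law_of_absolutely_continuous[OF \<mu>(1,2) ac])+
  have u0: "0 \<le> u x" for x by (simp add: u_def)
  obtain c0 where c0: "c0 \<ge> 0" "\<And>u. subdensity u \<Longrightarrow> 0 \<le> Wr u - \<kappa> * Pr u \<Longrightarrow> Pr u \<le> c0"
    using near_maximal_Pr_bound by blast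
  have small: "\<forall>\<^sub>F n in G. 1 / real (Suc n) < e" if "e > 0" for e
  proof -
    have "\<forall>\<^sub>F n in sequentially. 1 / real (Suc n) < e"
      using order_tendstoD(2)[OF lim_inverse_n', of e] that
      by (subst eventually_sequentially_Suc[of "\<lambda>n. 1 / real n < e"]) (auto simp: inverse_eq_divide)
    then show ?thesis by (rule filter_leD[OF G(2)])
  qed
  have Pr_c0: "\<forall>\<^sub>F n in G. Pr (w n) \<le> c0"
    using small[OF J_pos]
  proof eventually_elim
    case (elim n)
    then show ?case using near_max[of n] by (intro c0(2)[OF densitiesD(1)[OF w]]) linarith
  qed
  have lsc: "power_mass m u \<le> ennreal p" if "\<forall>\<^sub>F n in G. Pr (w n) \<le> p" for p
    by (rule power_mass_setwise_lsc[OF G(1) w _ u0 u(2) _ that]) (use lim in \<open>auto simp: u(1)\<close>)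
  have "power_mass m u < \<infinity>" using lsc[OF Pr_c0] by (simp add: order_le_less_trans)
  then have su: "subdensity u" and ud: "u \<in> densities" using u0 u(2) by (auto simp: subdensity_def densities_def)
  \<comment> \<open>One \<delta> pays for the close pairs of \<open>w n\<close>, one for the
    convergence of the far interaction, one for \<open>1 / real (Suc n)\<close>. The close pairs of
    the limit \<open>u\<close> are dropped, which only helps.\<close>
  have upper: "\<kappa> * Pr u \<le> Wr u - J + 3 * \<delta>" if \<delta>: "\<delta> > 0" for \<delta>
  proof -
    obtain r where r: "r > 0" "\<And>v. subdensity v \<Longrightarrow> power_mass m v \<le> ennreal c0 \<Longrightarrow> near r v \<le> ennreal \<delta>"
      using near_uniformly_small[OF c0(1) \<delta>] by blast
    define k where "k z = riesz \<alpha> z * indicator (- ball 0 r) z" for z :: 'a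
    define F where "F z = enn2real (k (fst z - snd z))" for z :: "'a \<times> 'a"
    have [measurable]: "ball (0::'a) r \<in> sets borel" by simp
    have [measurable]: "k \<in> borel_measurable borel" unfolding k_def by measurable
    have F_meas[measurable]: "F \<in> borel_measurable (borel \<Otimes>\<^sub>M borel)" unfolding F_def by measurable
    have k_le: "k z \<le> ennreal (r powr - \<alpha>)" for z unfolding k_def by (rule riesz_far_le[OF r(1) alpha_pos])
    have F: "0 \<le> F z" "F z \<le> r powr - \<alpha>" "ennreal (F z) = k (fst z - snd z)" for z
    proof -
      show "0 \<le> F z" by (simp add: F_def)
      show "F z \<le> r powr - \<alpha>" using k_le[of "fst z - snd z"] unfolding F_def by (intro enn2real_leI) auto
      have "k (fst z - snd z) < top" using k_le by (rule order_le_less_trans) simp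
      then show "ennreal (F z) = k (fst z - snd z)" by (simp add: F_def)
    qed
    have far: "interaction k v v = ennreal (integral\<^sup>L (law v \<Otimes>\<^sub>M law v) F)" if v: "v \<in> densities" for v
    proof -
      note [measurable] = densitiesD(3)[OF v]
      interpret prob_space "law v" by (rule prob_space_law) (use densitiesD[OF v] in auto)
      interpret pair_prob_space "law v" "law v" ..
      have Fm: "F \<in> borel_measurable (law v \<Otimes>\<^sub>M law v)" by measurable
      have "integrable (law v \<Otimes>\<^sub>M law v) F"
        by (rule P.integrable_const_bound[where B="r powr - \<alpha>"]) (use F Fm in auto)
      then have "ennreal (integral\<^sup>L (law v \<Otimes>\<^sub>M law v) F) = (\<integral>\<^sup>+z. ennreal (F z) \<partial>(law v \<Otimes>\<^sub>M law v))"
        using F(1) by (intro nn_integral_eq_integral[symmetric]) auto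
      also have "\<dots> = interaction k v v"
        unfolding F(3) by (rule interaction_law) (use densitiesD[OF v] in auto)
      finally show ?thesis ..
    qed
    have int_nonneg: "0 \<le> integral\<^sup>L (law v \<Otimes>\<^sub>M law v) F" for v
      by (intro integral_nonneg_AE) (simp add: F)
    have "((\<lambda>n. integral\<^sup>L (law (w n) \<Otimes>\<^sub>M law (w n)) F) \<longlongrightarrow> integral\<^sup>L \<nu> F) G"
      by (rule setwise_limit_integral[OF prob2 sets2 \<nu> lim2 F_meas F(1,2)]) (use r(1) in simp_all)
    then have "\<forall>\<^sub>F n in G. integral\<^sup>L (law (w n) \<Otimes>\<^sub>M law (w n)) F < integral\<^sup>L \<nu> F + \<delta>"
      using \<delta> by (intro order_tendstoD(2)) auto
    \<comment> \<open>The right-hand side does not depend on \<open>n\<close> and so can be used as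
      the constant \<open>p\<close> in \<open>lsc\<close>; the asymptotic upper bound on W and the
      lower semicontinuity of P are thus combined in one inequality.\<close>
    then have "\<forall>\<^sub>F n in G. Pr (w n) \<le> (Wr u - J + 3 * \<delta>) / \<kappa>"
      using Pr_c0 small[OF \<delta>]
    proof eventually_elim
      case (elim n)
      have sw: "subdensity (w n)" by (rule densitiesD(1)[OF w])
      have nr: "near r (w n) \<le> ennreal \<delta>"
        by (intro r(2) sw) (simp add: power_mass_eq_Pr[OF sw] ennreal_leI elim)
      have "ennreal (integral\<^sup>L \<nu> F) = interaction k u u" by (simp add: \<mu>(3) u(1) far[OF ud])
      also have "\<dots> \<le> W u" by (intro interaction_mono) (auto simp: k_def indicator_def)
      also have "\<dots> = ennreal (Wr u)" by (rule W_eq_Wr[OF su])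
      finally have Wu: "integral\<^sup>L \<nu> F \<le> Wr u" using Wr_nonneg[of u] by (simp add: ennreal_le_iff)
      have "ennreal (Wr (w n)) = near r (w n) + interaction k (w n) (w n)"
        unfolding W_eq_Wr[OF sw, symmetric] k_def by (rule riesz_near_far_split) (auto intro: densitiesD(3)[OF w])
      also have "\<dots> \<le> ennreal \<delta> + ennreal (integral\<^sup>L (law (w n) \<Otimes>\<^sub>M law (w n)) F)"
        unfolding far[OF w] by (intro add_right_mono nr)
      also have "\<dots> = ennreal (\<delta> + integral\<^sup>L (law (w n) \<Otimes>\<^sub>M law (w n)) F)"
        using \<delta> int_nonneg by simp
      finally have "Wr (w n) \<le> \<delta> + integral\<^sup>L (law (w n) \<Otimes>\<^sub>M law (w n)) F"
        using \<delta> int_nonneg[of "w n"] by (subst (asm) ennreal_le_iff) auto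
      then have "\<kappa> * Pr (w n) \<le> Wr u - J + 3 * \<delta>"
        using near_max[of n] elim Wu by linarith
      then show ?case using kappa_pos by (simp add: pos_le_divide_eq mult.commute)
    qed
    then have P: "power_mass m u \<le> ennreal ((Wr u - J + 3 * \<delta>) / \<kappa>)" by (rule lsc)
    \<comment> \<open>\<open>ennreal\<close> sends negative reals to 0, so the sign is needed to
      return to the reals. It is read off at one index, which exists because \<open>G\<close> is
      proper.\<close>
    have "0 \<le> (Wr u - J + 3 * \<delta>) / \<kappa>"
    proof -
      obtain n where "Pr (w n) \<le> (Wr u - J + 3 * \<delta>) / \<kappa>"
        using eventually_happens'[OF G(1) \<open>\<forall>\<^sub>F n in G. Pr (w n) \<le> (Wr u - J + 3 * \<delta>) / \<kappa>\<close>] by blast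
      then show ?thesis using Pr_nonneg[of "w n"] by linarith
    qed
    then have "Pr u \<le> (Wr u - J + 3 * \<delta>) / \<kappa>" using P by (simp add: power_mass_eq_Pr[OF su])
    then show ?thesis using kappa_pos by (simp add: pos_le_divide_eq mult.commute)
  qed
  have "\<kappa> * Pr u \<le> Wr u - J"
  proof (rule field_le_epsilon)
    fix e :: real assume "e > 0"
    then show "\<kappa> * Pr u \<le> Wr u - J + e" using upper[of "e / 3"] by simp
  qed
  then show ?thesis using le_J[OF ud] ud by (intro bexI[of _ u]) auto
qed

end

section \<open>The energy\<close>

lemma lebesgue_density_law:
  assumes [measurable]: "u \<in> borel_measurable borel" and u: "\<And>x. 0 \<le> u x"
  shows "AE x in lborel. lebesgue_density (law u) x = u x"
proof -
  have "AE x in lborel. ennreal (u x) = RN_deriv lborel (law u) x"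
    by (rule sigma_finite_measure.RN_deriv_unique[OF sigma_finite_lborel]) (auto simp: law_def)
  then show ?thesis
  proof eventually_elim
    case (elim x)
    then show ?case using u by (simp add: lebesgue_density_def flip: elim)
  qed
qed

lemma lebesgue_density_measurable[measurable]: "lebesgue_density \<rho> \<in> borel_measurable borel"
  using borel_measurable_RN_deriv[of lborel \<rho>] unfolding lebesgue_density_def by simp

text \<open>The kernel is negative everywhere, so only the negative part in
  \<open>ereal_integral\<close> survives. On the diagonal \<open>interaction_kernel\<close> is
  -\<infinity> and \<open>riesz\<close> is 0, but a measure with a density does not see this for
  fixed \<open>y\<close>.\<close>

lemma interaction_energy_law:
  fixes u :: "'a::euclidean_space \<Rightarrow> real"
  assumes [measurable]: "u \<in> borel_measurable borel" and "mass u = 1" and \<alpha>: "\<alpha> > 0"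
  shows "ereal_integral (law u) (\<lambda>y. ereal_integral (law u) (\<lambda>x. interaction_kernel (- \<alpha>) x y))
    = - enn2ereal (ennreal (1 / \<alpha>) * interaction (riesz \<alpha>) u u)"
proof -
  interpret prob_space "law u" by (rule prob_space_law) (use assms in auto)
  define \<psi> where "\<psi> y = ennreal (1 / \<alpha>) * (\<integral>\<^sup>+x. riesz \<alpha> (y - x) \<partial>law u)" for y
  have inner: "ereal_integral (law u) (\<lambda>x. interaction_kernel (- \<alpha>) x y) = - enn2ereal (\<psi> y)" for y
  proof -
    have "AE x in lborel. x \<noteq> y" by (rule AE_lborel_singleton)
    then have ne: "AE x in law u. x \<noteq> y" unfolding law_def by (subst AE_density) auto
    have "(\<integral>\<^sup>+x. e2ennreal (interaction_kernel (- \<alpha>) x y) \<partial>law u) = (\<integral>\<^sup>+x. 0 \<partial>law u)"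
      using \<alpha> by (intro nn_integral_cong) (simp add: interaction_kernel_def e2ennreal_neg)
    moreover have "(\<integral>\<^sup>+x. e2ennreal (- interaction_kernel (- \<alpha>) x y) \<partial>law u)
        = (\<integral>\<^sup>+x. ennreal (1 / \<alpha>) * riesz \<alpha> (y - x) \<partial>law u)"
    proof (rule nn_integral_cong_AE)
      show "AE x in law u. e2ennreal (- interaction_kernel (- \<alpha>) x y) = ennreal (1 / \<alpha>) * riesz \<alpha> (y - x)"
        using ne
      proof eventually_elim
        case (elim x)
        then show ?case using \<alpha>
          by (simp add: interaction_kernel_def riesz_def ennreal_mult[symmetric] norm_minus_commute ennreal.abs_eq[symmetric] flip: ennreal_def)
      qed
    qed
    moreover have "\<dots> = \<psi> y" unfolding \<psi>_def by (rule nn_integral_cmult) measurable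
    ultimately show ?thesis unfolding ereal_integral_def by (simp add: zero_ennreal.rep_eq)
  qed
  have [measurable]: "\<psi> \<in> borel_measurable borel" unfolding \<psi>_def by measurable
  have "(\<integral>\<^sup>+y. \<psi> y \<partial>law u) = ennreal (1 / \<alpha>) * (\<integral>\<^sup>+y. \<integral>\<^sup>+x. riesz \<alpha> (y - x) \<partial>law u \<partial>law u)"
    unfolding \<psi>_def by (rule nn_integral_cmult) measurable
  also have "(\<integral>\<^sup>+y. \<integral>\<^sup>+x. riesz \<alpha> (y - x) \<partial>law u \<partial>law u) = (\<integral>\<^sup>+z. riesz \<alpha> (fst z - snd z) \<partial>(law u \<Otimes>\<^sub>M law u))"
    by (subst nn_integral_fst[symmetric]) auto
  also have "\<dots> = interaction (riesz \<alpha>) u u" by (rule interaction_law) (use assms in auto)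
  finally have \<psi>: "(\<integral>\<^sup>+y. \<psi> y \<partial>law u) = ennreal (1 / \<alpha>) * interaction (riesz \<alpha>) u u" .
  have "e2ennreal (- enn2ereal (\<psi> y)) = 0" for y by (rule e2ennreal_neg) simp
  then show ?thesis
    unfolding inner by (simp add: ereal_integral_def \<psi> zero_ennreal.rep_eq)
qed

context aggregation_diffusion
begin

lemma energy_law:
  assumes u: "u \<in> densities"
  shows "energy m (- \<alpha>) \<epsilon> (law u) = ereal (\<epsilon> / (m - 1) * Pr u - Wr u / \<alpha>)"
proof -
  note [measurable] = densitiesD(3)[OF u]
  note u0 = densitiesD(4)[OF u]
  have ae: "AE x in lborel. lebesgue_density (law u) x = u x"
    by (rule lebesgue_density_law) (use densitiesD[OF u] in auto)
  have int: "integrable lborel (\<lambda>x. u x powr m)"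
    using densitiesD(5)[OF u] by (intro integrableI_nonneg) (auto simp: power_mass_def)
  have "integrable lborel (\<lambda>x. lebesgue_density (law u) x powr m)"
    by (rule integrable_cong_AE_imp[OF int]) (use ae in auto)
  moreover have "absolutely_continuous lborel (law u)"
    unfolding law_def by (rule absolutely_continuousI_density) measurable
  ultimately have "has_density_in_L m (law u)" by (simp add: has_density_in_L_def)
  moreover have "(LINT x|lborel. lebesgue_density (law u) x powr m / (m - 1)) = Pr u / (m - 1)"
  proof -
    have "(LINT x|lborel. lebesgue_density (law u) x powr m / (m - 1)) = (LINT x|lborel. u x powr m / (m - 1))"
    proof (rule integral_cong_AE)
      show "AE x in lborel. lebesgue_density (law u) x powr m / (m - 1) = u x powr m / (m - 1)"
        using ae by eventually_elim simp
    qed measurable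
    also have "\<dots> = (LINT x|lborel. u x powr m) / (m - 1)" by simp
    also have "(LINT x|lborel. u x powr m) = Pr u"
      unfolding Pr_def power_mass_def by (rule integral_eq_nn_integral) auto
    finally show ?thesis .
  qed
  moreover have "ereal_integral (law u) (\<lambda>y. ereal_integral (law u) (\<lambda>x. interaction_kernel (- \<alpha>) x y)) = ereal (- (Wr u / \<alpha>))"
  proof -
    have "ennreal (1 / \<alpha>) * W u = ennreal (Wr u / \<alpha>)"
      using alpha_pos by (simp add: W_eq_Wr[OF densitiesD(1)[OF u]] ennreal_mult[symmetric] Wr_nonneg)
    then show ?thesis
      using interaction_energy_law[of u \<alpha>] densitiesD[OF u] alpha_pos Wr_nonneg[of u]
      by (simp add: enn2ereal_ennreal)
  qed
  ultimately show ?thesis using m_gt_1 by (simp add: energy_def)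
qed

text \<open>Every competitor is thus either covered by the variational problem for \<open>J\<close>
  or has infinite energy.\<close>

lemma energy_cases:
  fixes \<rho> :: "'a measure"
  assumes "\<rho> \<in> borel_prob_measures"
  obtains u where "u \<in> densities" "\<rho> = law u" | "\<And>\<epsilon>. energy m (- \<alpha>) \<epsilon> \<rho> = \<infinity>"
proof (cases "has_density_in_L m \<rho>")
  case True
  have \<rho>: "prob_space \<rho>" "sets \<rho> = sets borel" "absolutely_continuous lborel \<rho>"
    using assms True by (auto simp: borel_prob_measures_def has_density_in_L_def)
  define u where "u = lebesgue_density \<rho>"
  note u = law_of_absolutely_continuous[OF \<rho>, folded lebesgue_density_def, folded u_def]
  have "integrable lborel (\<lambda>x. u x powr m)" using True by (simp add: has_density_in_L_def u_def)
  then have "power_mass m u < \<infinity>"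
    unfolding power_mass_def using integrable_iff_bounded[of lborel "\<lambda>x. u x powr m"] by simp
  moreover have "0 \<le> u x" for x by (simp add: u_def lebesgue_density_def)
  ultimately have "u \<in> densities" using u by (simp add: densities_def subdensity_def)
  then show ?thesis using that(1) u(2) by blast
next
  case False
  then show ?thesis using that(2) by (simp add: energy_def)
qed

lemma law_in_borel_prob_measures: "u \<in> densities \<Longrightarrow> law u \<in> borel_prob_measures"
  using prob_space_law[of u] densitiesD[of u] by (simp add: borel_prob_measures_def)

end

text \<open>The first conjunct expresses that the energy takes values in (-\<infinity>,
  \<infinity>].\<close>

theorem theorem5p1:
  fixes m \<beta> \<epsilon> :: real
  assumes "m > 1"
    and "0 > \<beta>" and "\<beta> > (1 - m) * real DIM('a::euclidean_space)"
    and "\<beta> > - real DIM('a)"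
    and "\<epsilon> > 0"
  shows "(\<forall>\<rho>\<in>(borel_prob_measures :: 'a measure set). energy m \<beta> \<epsilon> \<rho> \<noteq> - \<infinity>) \<and>
         (\<exists>\<rho> :: 'a measure. global_minimizer (energy m \<beta> \<epsilon>) \<rho>)"
proof -
  define \<alpha> \<kappa> where "\<alpha> = - \<beta>" and "\<kappa> = \<alpha> * \<epsilon> / (m - 1)"
  have \<alpha>: "\<alpha> > 0" using assms by (simp add: \<alpha>_def)
  have \<kappa>: "\<kappa> > 0" using assms \<alpha> by (simp add: \<kappa>_def)
  interpret aggregation_diffusion \<alpha> m "\<alpha> / real DIM('a)" \<kappa> "TYPE('a)"
    using assms \<alpha> \<kappa> by unfold_locales (auto simp: \<alpha>_def algebra_simps)
  have en: "energy m \<beta> \<epsilon> (law u) = ereal ((\<kappa> * Pr u - Wr u) / \<alpha>)" if "u \<in> densities" for u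
    using energy_law[OF that, of \<epsilon>] \<alpha> by (simp add: \<kappa>_def diff_divide_distrib) (simp add: \<alpha>_def)
  have inf: "energy m \<beta> \<epsilon> \<rho> = \<infinity>" if "\<And>\<epsilon>. energy m (- \<alpha>) \<epsilon> \<rho> = \<infinity>" for \<rho> :: "'a measure"
    using that[of \<epsilon>] by (simp add: \<alpha>_def)
  obtain u where u: "u \<in> densities" "Wr u - \<kappa> * Pr u = J" using maximiser_exists by blast
  have "energy m \<beta> \<epsilon> (law u) \<le> energy m \<beta> \<epsilon> \<nu>" if "\<nu> \<in> borel_prob_measures" for \<nu> :: "'a measure"
    using energy_cases[OF that]
  proof cases
    case (1 v)
    have "\<kappa> * Pr u - Wr u \<le> \<kappa> * Pr v - Wr v" using le_J[OF 1(1)] u(2) by linarith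
    then show ?thesis using \<alpha> by (simp add: en 1 u(1) divide_right_mono)
  next
    case 2
    then show ?thesis by (simp add: inf)
  qed
  then have "global_minimizer (energy m \<beta> \<epsilon>) (law u)"
    using law_in_borel_prob_measures[OF u(1)] by (simp add: global_minimizer_def)
  moreover have "energy m \<beta> \<epsilon> \<rho> \<noteq> - \<infinity>" if "\<rho> \<in> borel_prob_measures" for \<rho> :: "'a measure"
    using energy_cases[OF that] by cases (auto simp: en inf)
  ultimately show ?thesis by blast
qed

end
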